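(* Let $K$ be a field of characteristic $0$, let $n$ be a positive integer, and let $V_n$ be an $n$-dimensional $K$-vector space with distinguished basis $x_1,\dots,x_n$. Let $f \in \bigwedge V_n$ be a generic form of degree $d$, with $d$ even. Then the Hilbert series of the graded quotient algebra $\frac{\bigwedge V_n}{(f)}$ is $$\sum_{i\ge 0} \dim_K\left(\frac{\bigwedge V_n}{(f)}\right)_i t^i = \left\langle (1+t)^n(1-t^d) \right\rangle .$$
   Context: $\bigwedge V_n$ is the exterior algebra on $V_n$, graded by degree; the square-free monomials $x_{i_1}x_{i_2}\cdots x_{i_d}$ with $i_1<\dots<i_d$ (products taken in the exterior algebra) form a $K$-basis of its degree $d$ part $\bigwedge^d V_n$. $(f)$ denotes the ideal generated by $f$. Generic form: since $K$ has characteristic $0$, its prime subfield is $\mathbb{Q}$. A form $f=\sum_m c_m m \in \bigwedge^d V_n$, where $m$ ranges over all square-free monomials of degree $d$ and $c_m\in K$, is called generic if (1) $c_m\notin\mathbb{Q}$ for all $m$; (2) $m\ne m'$ implies $c_m\neq c_{m'}$; (3) the set of all the $c_m$ is algebraically independent over $\mathbb{Q}$. Truncation: for a formal power series $g(t)=\sum_{i\ge0} a_i t^i\in\mathbb{Z}[[t]]$, define $\langle g(t)\rangle = \sum_{i=0}^{\ell} a_i t^i$ with $\ell=\max\{\, i \mid a_j>0 \text{ for all } 0\le j\le i\,\}$, where the maximum of the empty set is $-1$ (so that then $\langle g(t)\rangle=0$) and $\ell=+\infty$ if all $a_j>0$. That is, the series is truncated just before its first non-positive coefficient. *)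

theory Defs
  imports
    "Jordan_Normal_Form.VS_Connect"
    "HOL-Algebra.QuotRing"
    "HOL-Library.Poly_Mapping"
    "HOL-Computational_Algebra.Formal_Power_Series"
begin

section \<open>The exterior algebra of a vector space with a distinguished basis\<close>

text \<open>
  An element of the exterior algebra on \<open>x\<^sub>1, \<dots>, x\<^sub>n\<close> is given by its coordinates with respect to the
  square-free monomials: the coefficient of \<open>x\<^bsub>i\<^sub>1\<^esub> \<cdots> x\<^bsub>i\<^sub>d\<^esub>\<close>, where \<open>i\<^sub>1 < \<dots> < i\<^sub>d\<close>, is the value at the set
  \<open>{i\<^sub>1, \<dots>, i\<^sub>d}\<close>. For disjoint \<open>A\<close> and \<open>B\<close>, sorting the concatenation of the two increasing words
  of \<open>A\<close> and \<open>B\<close> takes as many adjacent transpositions as there are pairs \<open>b < a\<close>.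
\<close>

definition inversions :: "nat set \<Rightarrow> nat set \<Rightarrow> (nat \<times> nat) set" where
  "inversions A B = {(a, b). a \<in> A \<and> b \<in> B \<and> b < a}"

definition merge_sign :: "nat set \<Rightarrow> nat set \<Rightarrow> 'k::comm_ring_1" where
  "merge_sign A B = (- 1) ^ card (inversions A B)"

definition wedge :: "(nat set \<Rightarrow> 'k::comm_ring_1) \<Rightarrow> (nat set \<Rightarrow> 'k) \<Rightarrow> nat set \<Rightarrow> 'k" where
  "wedge u v = (\<lambda>S. \<Sum>A\<in>Pow S. merge_sign A (S - A) * u A * v (S - A))"

definition ext_monomial :: "nat set \<Rightarrow> nat set \<Rightarrow> 'k::comm_ring_1" where
  "ext_monomial S = (\<lambda>T. if T = S then 1 else 0)"

definition exterior_algebra :: "nat \<Rightarrow> ('k::field, nat set \<Rightarrow> 'k) module" where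
  "exterior_algebra n =
     \<lparr>carrier = {u. \<forall>S. u S \<noteq> 0 \<longrightarrow> S \<subseteq> {1..n}},
      monoid.mult = wedge,
      one = ext_monomial {},
      zero = (\<lambda>_. 0),
      add = (\<lambda>u v S. u S + v S),
      smult = (\<lambda>c u S. c * u S)\<rparr>"

definition squarefree_monomials :: "nat \<Rightarrow> nat \<Rightarrow> nat set set" where
  "squarefree_monomials n d = {S. S \<subseteq> {1..n} \<and> card S = d}"

definition ext_degree :: "nat \<Rightarrow> nat \<Rightarrow> (nat set \<Rightarrow> 'k::field) set" where
  "ext_degree n d = {u. \<forall>S. u S \<noteq> 0 \<longrightarrow> S \<in> squarefree_monomials n d}"

section \<open>The graded quotient by a principal ideal\<close>

definition ext_ideal :: "nat \<Rightarrow> (nat set \<Rightarrow> 'k::field) \<Rightarrow> (nat set \<Rightarrow> 'k) set" where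
  "ext_ideal n f = Idl\<^bsub>exterior_algebra n\<^esub> {f}"

text \<open>
  The quotient by the two-sided ideal \<open>(f)\<close>, with scalars acting by \<open>c (u + (f)) = c u + (f)\<close>. The union has the same form as in
  \<^const>\<open>rcoset_mult\<close>; it is a single coset by \<open>ext_quotient_smult_coset\<close> below.
\<close>

definition ext_quotient :: "nat \<Rightarrow> (nat set \<Rightarrow> 'k::field) \<Rightarrow> ('k, (nat set \<Rightarrow> 'k) set) module" where
  "ext_quotient n f =
     ring.extend (exterior_algebra n Quot ext_ideal n f)
       \<lparr>smult = (\<lambda>c X. \<Union>u\<in>X. ext_ideal n f +>\<^bsub>exterior_algebra n\<^esub> (c \<odot>\<^bsub>exterior_algebra n\<^esub> u))\<rparr>"

definition ext_quotient_degree ::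
    "nat \<Rightarrow> (nat set \<Rightarrow> 'k::field) \<Rightarrow> nat \<Rightarrow> ('k, (nat set \<Rightarrow> 'k) set) module" where
  "ext_quotient_degree n f i =
     (ext_quotient n f)\<lparr>carrier :=
        (\<lambda>u. ext_ideal n f +>\<^bsub>exterior_algebra n\<^esub> u) ` ext_degree n i\<rparr>"

definition hilbert_series_ext_quotient :: "nat \<Rightarrow> (nat set \<Rightarrow> 'k::field) \<Rightarrow> int fps" where
  "hilbert_series_ext_quotient n f =
     Abs_fps (\<lambda>i. int (vectorspace.dim class_ring (ext_quotient_degree n f i)))"

section \<open>Generic forms\<close>

text \<open>
  \<open>p\<close> ranges over the polynomials with rational coefficients whose variables are indexed by the
  elements of \<open>A\<close>; the sum is its value at the point that assigns \<open>a\<close> to the variable of index \<open>a\<close>.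
\<close>

definition alg_independent_rat :: "'k::field_char_0 set \<Rightarrow> bool" where
  "alg_independent_rat A \<longleftrightarrow>
     (\<forall>p :: ('k \<Rightarrow>\<^sub>0 nat) \<Rightarrow>\<^sub>0 rat.
        (\<forall>m \<in> Poly_Mapping.keys p. Poly_Mapping.keys m \<subseteq> A) \<longrightarrow>
        (\<Sum>m \<in> Poly_Mapping.keys p.
           of_rat (Poly_Mapping.lookup p m) *
           (\<Prod>a \<in> Poly_Mapping.keys m. a ^ Poly_Mapping.lookup m a)) = 0 \<longrightarrow>
        p = 0)"

definition generic_form :: "nat \<Rightarrow> nat \<Rightarrow> (nat set \<Rightarrow> 'k::field_char_0) \<Rightarrow> bool" where
  "generic_form n d f \<longleftrightarrow>
     f \<in> ext_degree n d \<and>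
     (\<forall>m \<in> squarefree_monomials n d. f m \<notin> \<rat>) \<and>
     (\<forall>m \<in> squarefree_monomials n d. \<forall>m' \<in> squarefree_monomials n d. m \<noteq> m' \<longrightarrow> f m \<noteq> f m') \<and>
     alg_independent_rat (f ` squarefree_monomials n d)"

section \<open>Truncation before the first non-positive coefficient\<close>

text \<open>
  The three cases are \<open>\<ell> = \<infinity>\<close>, \<open>\<ell> = -1\<close> and \<open>\<ell> = Max L\<close>.
\<close>

definition fps_truncate_pos :: "int fps \<Rightarrow> int fps" where
  "fps_truncate_pos g =
     (let L = {i. \<forall>j\<le>i. fps_nth g j > 0} in
      if \<forall>j. fps_nth g j > 0 then g
      else if L = {} then 0
      else fps_cutoff (Suc (Max L)) g)"

section \<open>Basic facts\<close>

text \<open>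
  The following facts show that the concrete model is the exterior algebra: it is an associative
  unital algebra, vectors square to zero, and the basis consists of the increasing products of
  the \<open>x\<^sub>i\<close>.
\<close>

lemma finite_inversions:
  "finite A \<Longrightarrow> finite B \<Longrightarrow> finite (inversions A B)"
  by (rule finite_subset[of _ "A \<times> B"]) (auto simp: inversions_def)

lemma merge_sign_Un_left:
  assumes "finite A" "finite B" "finite C" "A \<inter> B = {}"
  shows "merge_sign (A \<union> B) C = merge_sign A C * (merge_sign B C :: 'k::comm_ring_1)"
proof -
  have "inversions (A \<union> B) C = inversions A C \<union> inversions B C"
    and "inversions A C \<inter> inversions B C = {}"
    using assms by (auto simp: inversions_def)
  then show ?thesis
    using assms by (simp add: merge_sign_def card_Un_disjoint finite_inversions power_add)
qed

lemma merge_sign_Un_right: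
  assumes "finite A" "finite B" "finite C" "B \<inter> C = {}"
  shows "merge_sign A (B \<union> C) = merge_sign A B * (merge_sign A C :: 'k::comm_ring_1)"
proof -
  have "inversions A (B \<union> C) = inversions A B \<union> inversions A C"
    and "inversions A B \<inter> inversions A C = {}"
    using assms by (auto simp: inversions_def)
  then show ?thesis
    using assms by (simp add: merge_sign_def card_Un_disjoint finite_inversions power_add)
qed

lemma merge_sign_empty [simp]: "merge_sign {} B = 1" "merge_sign A {} = 1"
  by (simp_all add: merge_sign_def inversions_def)

lemma wedge_infinite: "infinite S \<Longrightarrow> wedge u v S = 0"
  by (simp add: wedge_def finite_Pow_iff)

lemma wedge_assoc: "wedge (wedge u v) w = wedge u (wedge v w)"
proof
  fix S
  show "wedge (wedge u v) w S = wedge u (wedge v w) S"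
  proof (cases "finite S")
    case True
    have fin: "finite A" if "A \<subseteq> S" for A
      using True that by (rule rev_finite_subset)
    have "wedge (wedge u v) w S =
      (\<Sum>D\<in>Pow S. \<Sum>A\<in>Pow D. merge_sign D (S - D) * (merge_sign A (D - A) * u A * v (D - A)) * w (S - D))"
      by (simp add: wedge_def sum_distrib_left sum_distrib_right)
    also have "\<dots> = (\<Sum>(D, A) \<in> Sigma (Pow S) Pow.
        merge_sign D (S - D) * (merge_sign A (D - A) * u A * v (D - A)) * w (S - D))"
      by (subst sum.Sigma) (auto simp: True fin)
    also have "\<dots> = (\<Sum>(A, B) \<in> Sigma (Pow S) (\<lambda>A. Pow (S - A)).
        merge_sign A (S - A) * u A * (merge_sign B (S - A - B) * v B * w (S - A - B)))"
    proof (rule sum.reindex_bij_witness[where j = "\<lambda>(D, A). (A, D - A)" and i = "\<lambda>(A, B). (A \<union> B, A)"],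
        goal_cases)
      case (5 p)
      then obtain D A where p: "p = (D, A)" "A \<subseteq> D" "D \<subseteq> S" by auto
      have S: "S - A = (D - A) \<union> (S - D)" "S - A - (D - A) = S - D" and D: "D = A \<union> (D - A)"
        using p by auto
      have f: "finite A" "finite D" "finite (S - D)"
        using p True fin by (auto intro: finite_subset)
      have "merge_sign D (S - D) = merge_sign A (S - D) * (merge_sign (D - A) (S - D) :: 'a)"
        by (subst D, rule merge_sign_Un_left) (use f in auto)
      moreover have "merge_sign A (S - A) = merge_sign A (D - A) * (merge_sign A (S - D) :: 'a)"
        unfolding S by (rule merge_sign_Un_right) (use f in auto)
      ultimately show ?case
        unfolding p prod.case S(2) by (simp add: algebra_simps)
    qed auto
    also have "\<dots> = (\<Sum>A\<in>Pow S. \<Sum>B\<in>Pow (S - A).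
        merge_sign A (S - A) * u A * (merge_sign B (S - A - B) * v B * w (S - A - B)))"
      by (subst sum.Sigma) (auto simp: True fin)
    also have "\<dots> = wedge u (wedge v w) S"
      by (simp add: wedge_def sum_distrib_left)
    finally show ?thesis .
  qed (simp add: wedge_infinite)
qed

lemma wedge_supp:
  assumes "\<And>S. u S \<noteq> 0 \<Longrightarrow> S \<subseteq> X" "\<And>S. v S \<noteq> 0 \<Longrightarrow> S \<subseteq> X" "wedge u v S \<noteq> 0"
  shows "S \<subseteq> X"
proof -
  from assms(3) obtain A where "A \<subseteq> S" "merge_sign A (S - A) * u A * v (S - A) \<noteq> 0"
    unfolding wedge_def by (metis (no_types, lifting) PowD sum.not_neutral_contains_not_neutral)
  then have "u A \<noteq> 0" "v (S - A) \<noteq> 0" by auto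
  then show ?thesis using assms(1)[of A] assms(2)[of "S - A"] by blast
qed

lemma wedge_one_left: "wedge (ext_monomial {}) u S = u S" if "finite S"
proof -
  have "wedge (ext_monomial {}) u S = (\<Sum>A\<in>Pow S. if A = {} then u S else 0)"
    unfolding wedge_def ext_monomial_def by (rule sum.cong) auto
  then show ?thesis using that by simp
qed

lemma wedge_one_right: "wedge u (ext_monomial {}) S = u S" if "finite S"
proof -
  have "wedge u (ext_monomial {}) S = (\<Sum>A\<in>Pow S. if A = S then u S else 0)"
    unfolding wedge_def ext_monomial_def by (rule sum.cong) auto
  then show ?thesis using that by simp
qed

lemma exterior_algebra_ring: "ring (exterior_algebra n :: ('k::field, nat set \<Rightarrow> 'k) module)"
proof (rule ringI)
  show "abelian_group (exterior_algebra n :: ('k, nat set \<Rightarrow> 'k) module)"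
  proof (rule abelian_groupI)
    fix u :: "nat set \<Rightarrow> 'k"
    assume "u \<in> carrier (exterior_algebra n)"
    then show "\<exists>v\<in>carrier (exterior_algebra n).
        v \<oplus>\<^bsub>exterior_algebra n\<^esub> u = \<zero>\<^bsub>exterior_algebra n\<^esub>"
      by (intro bexI[of _ "\<lambda>S. - u S"]) (auto simp: exterior_algebra_def)
  next
    fix u v :: "nat set \<Rightarrow> 'k"
    assume *: "u \<in> carrier (exterior_algebra n)" "v \<in> carrier (exterior_algebra n)"
    have "S \<subseteq> {1..n}" if "u S + v S \<noteq> 0" for S
    proof -
      from that have "u S \<noteq> 0 \<or> v S \<noteq> 0" by auto
      with * show ?thesis by (auto simp: exterior_algebra_def)
    qed
    then show "u \<oplus>\<^bsub>exterior_algebra n\<^esub> v \<in> carrier (exterior_algebra n)"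
      by (simp add: exterior_algebra_def)
  qed (simp_all add: exterior_algebra_def ac_simps)
  have fin: "wedge (ext_monomial {}) u = u" "wedge u (ext_monomial {}) = u"
    if "u \<in> carrier (exterior_algebra n)" for u :: "nat set \<Rightarrow> 'k"
  proof -
    have u0: "u S = 0" if "infinite S" for S
      using \<open>u \<in> _\<close> that finite_subset[of S "{1..n}"] by (auto simp: exterior_algebra_def)
    show "wedge (ext_monomial {}) u = u"
    proof
      fix S show "wedge (ext_monomial {}) u S = u S"
        by (cases "finite S") (auto simp: wedge_one_left wedge_infinite u0)
    qed
    show "wedge u (ext_monomial {}) = u"
    proof
      fix S show "wedge u (ext_monomial {}) S = u S"
        by (cases "finite S") (auto simp: wedge_one_right wedge_infinite u0)
    qed
  qed
  show "Group.monoid (exterior_algebra n :: ('k, nat set \<Rightarrow> 'k) module)"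
  proof (rule monoidI)
    fix u v :: "nat set \<Rightarrow> 'k"
    assume "u \<in> carrier (exterior_algebra n)" "v \<in> carrier (exterior_algebra n)"
    then show "u \<otimes>\<^bsub>exterior_algebra n\<^esub> v \<in> carrier (exterior_algebra n)"
      using wedge_supp[of u "{1..n}" v] by (simp add: exterior_algebra_def)
  next
    fix u :: "nat set \<Rightarrow> 'k"
    assume "u \<in> carrier (exterior_algebra n)"
    from fin[OF this]
    show "\<one>\<^bsub>exterior_algebra n\<^esub> \<otimes>\<^bsub>exterior_algebra n\<^esub> u = u"
      "u \<otimes>\<^bsub>exterior_algebra n\<^esub> \<one>\<^bsub>exterior_algebra n\<^esub> = u"
      by (simp_all add: exterior_algebra_def)
  qed (auto simp: exterior_algebra_def ext_monomial_def wedge_assoc)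
qed (auto simp: exterior_algebra_def wedge_def fun_eq_iff algebra_simps sum.distrib)

lemma exterior_algebra_module:
  "Module.module class_ring (exterior_algebra n :: ('k::field, nat set \<Rightarrow> 'k) module)"
proof (rule moduleI)
  show "cring (class_ring :: 'k ring)" by (rule class_cring.is_cring)
  show "abelian_group (exterior_algebra n :: ('k, nat set \<Rightarrow> 'k) module)"
    using exterior_algebra_ring by (rule ring.is_abelian_group)
qed (simp_all add: exterior_algebra_def distrib_left distrib_right mult.assoc)

lemma exterior_algebra_smult_mult:
  "(c \<odot>\<^bsub>exterior_algebra n\<^esub> u) \<otimes>\<^bsub>exterior_algebra n\<^esub> v = c \<odot>\<^bsub>exterior_algebra n\<^esub> (u \<otimes>\<^bsub>exterior_algebra n\<^esub> v)"
  "u \<otimes>\<^bsub>exterior_algebra n\<^esub> (c \<odot>\<^bsub>exterior_algebra n\<^esub> v) = c \<odot>\<^bsub>exterior_algebra n\<^esub> (u \<otimes>\<^bsub>exterior_algebra n\<^esub> v)"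
  by (simp_all add: exterior_algebra_def wedge_def sum_distrib_left algebra_simps)

lemma wedge_monomials:
  assumes "A \<inter> B = {}" "finite A" "finite B"
  shows "wedge (ext_monomial A) (ext_monomial B) = (\<lambda>S. merge_sign A B * ext_monomial (A \<union> B) S)"
proof
  fix S
  show "wedge (ext_monomial A) (ext_monomial B) S = merge_sign A B * (ext_monomial (A \<union> B) S :: 'a)"
  proof (cases "finite S")
    case True
    have "wedge (ext_monomial A) (ext_monomial B) S =
        (\<Sum>C\<in>Pow S. if C = A then merge_sign A B * (ext_monomial (A \<union> B) S :: 'a) else 0)"
      unfolding wedge_def ext_monomial_def
      by (rule sum.cong) (use assms in \<open>auto simp: Un_absorb1\<close>)
    also have "\<dots> = merge_sign A B * ext_monomial (A \<union> B) S"
      using True by (auto simp: ext_monomial_def)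
    finally show ?thesis .
  next
    case False
    then show ?thesis using assms by (auto simp: wedge_infinite ext_monomial_def)
  qed
qed

lemma ext_monomial_conv_product:
  assumes "finite S"
  shows "ext_monomial S =
    foldr wedge (map (\<lambda>i. ext_monomial {i}) (sorted_list_of_set S)) (ext_monomial {})"
proof -
  have "foldr wedge (map (\<lambda>i. ext_monomial {i}) xs) (ext_monomial {}) = (ext_monomial (set xs) :: _ \<Rightarrow> 'a)"
    if "sorted_wrt (<) xs" for xs
    using that
  proof (induction xs)
    case (Cons a xs)
    then have "inversions {a} (set xs) = {}" "a \<notin> set xs"
      by (auto simp: inversions_def)
    with Cons show ?case
      by (simp add: wedge_monomials merge_sign_def)
  qed simp
  from this[of "sorted_list_of_set S"] assms show ?thesis by simp
qed

lemma wedge_self_eq_0: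
  fixes v :: "nat set \<Rightarrow> 'k::field_char_0"
  assumes "v \<in> ext_degree n 1"
  shows "wedge v v = (\<lambda>_. 0)"
proof
  fix S
  define t where "t A = merge_sign A (S - A) * v A * v (S - A)" for A
  have "t (S - A) = - t A" if "A \<subseteq> S" for A
  proof (cases "v A = 0 \<or> v (S - A) = 0")
    case False
    then have "card A = 1" "card (S - A) = 1"
      using assms by (auto simp: ext_degree_def squarefree_monomials_def)
    then obtain a b where ab: "A = {a}" "S - A = {b}"
      by (metis card_1_singletonE)
    then have "a \<noteq> b" by auto
    have SA: "S - {b} = {a}" using that ab by auto
    have "inversions {a} {b} = (if b < a then {(a, b)} else {})"
      "inversions {b} {a} = (if a < b then {(b, a)} else {})"
      by (auto simp: inversions_def)
    then have "merge_sign {b} {a} = - (merge_sign {a} {b} :: 'k)"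
      using \<open>a \<noteq> b\<close> by (auto simp: merge_sign_def)
    then show ?thesis
      unfolding t_def ab(2) SA using ab by simp
  qed (use that in \<open>auto simp: t_def double_diff\<close>)
  then have "(\<Sum>A\<in>Pow S. t (S - A)) = - (\<Sum>A\<in>Pow S. t A)"
    by (simp add: sum_negf)
  moreover have "(\<Sum>A\<in>Pow S. t (S - A)) = (\<Sum>A\<in>Pow S. t A)"
    by (rule sum.reindex_bij_witness[of _ "\<lambda>A. S - A" "\<lambda>A. S - A"]) (auto simp: double_diff)
  ultimately show "wedge v v S = 0"
    by (simp add: wedge_def t_def)
qed

text \<open>
  The homogeneous components of the quotient are vector spaces over \<open>K\<close>, so that
  \<^const>\<open>vectorspace.dim\<close> in \<^const>\<open>hilbert_series_ext_quotient\<close> is applied inside its locale.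
\<close>

lemma ext_degree_subset: "ext_degree n d \<subseteq> carrier (exterior_algebra n)"
  by (auto simp: ext_degree_def exterior_algebra_def squarefree_monomials_def)

lemma ext_ideal_ideal:
  assumes "f \<in> carrier (exterior_algebra n)"
  shows "ideal (ext_ideal n f) (exterior_algebra n)"
  unfolding ext_ideal_def
  using assms by (intro ring.genideal_ideal exterior_algebra_ring) auto

lemma ext_quotient_simps:
  "carrier (ext_quotient n f) = carrier (exterior_algebra n Quot ext_ideal n f)"
  "X \<otimes>\<^bsub>ext_quotient n f\<^esub> Y = X \<otimes>\<^bsub>exterior_algebra n Quot ext_ideal n f\<^esub> Y"
  "\<one>\<^bsub>ext_quotient n f\<^esub> = \<one>\<^bsub>exterior_algebra n Quot ext_ideal n f\<^esub>"
  "\<zero>\<^bsub>ext_quotient n f\<^esub> = \<zero>\<^bsub>exterior_algebra n Quot ext_ideal n f\<^esub>"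
  "X \<oplus>\<^bsub>ext_quotient n f\<^esub> Y = X \<oplus>\<^bsub>exterior_algebra n Quot ext_ideal n f\<^esub> Y"
  "c \<odot>\<^bsub>ext_quotient n f\<^esub> X =
     (\<Union>u\<in>X. ext_ideal n f +>\<^bsub>exterior_algebra n\<^esub> (c \<odot>\<^bsub>exterior_algebra n\<^esub> u))"
  by (simp_all add: ext_quotient_def ring.extend_def)

context
  fixes n :: nat and f :: "nat set \<Rightarrow> 'k::field"
  assumes f: "f \<in> carrier (exterior_algebra n)"
begin

interpretation E: Module.module class_ring "exterior_algebra n :: ('k, nat set \<Rightarrow> 'k) module"
  by (rule exterior_algebra_module)

interpretation I: ideal "ext_ideal n f" "exterior_algebra n"
  using f by (rule ext_ideal_ideal)

lemma ext_smult_ideal: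
  assumes "u \<in> ext_ideal n f"
  shows "c \<odot>\<^bsub>exterior_algebra n\<^esub> u \<in> ext_ideal n f"
proof -
  have u: "u \<in> carrier (exterior_algebra n)" using assms by (rule I.a_Hcarr)
  have "c \<odot>\<^bsub>exterior_algebra n\<^esub> u =
      (c \<odot>\<^bsub>exterior_algebra n\<^esub> \<one>\<^bsub>exterior_algebra n\<^esub>) \<otimes>\<^bsub>exterior_algebra n\<^esub> u"
    using I.l_one[OF u] by (simp add: exterior_algebra_smult_mult)
  also have "\<dots> \<in> ext_ideal n f"
    using assms by (intro I.I_l_closed E.smult_closed I.one_closed) auto
  finally show ?thesis .
qed

lemma ext_quotient_smult_coset:
  assumes u: "u \<in> carrier (exterior_algebra n)"
  shows "c \<odot>\<^bsub>ext_quotient n f\<^esub> (ext_ideal n f +>\<^bsub>exterior_algebra n\<^esub> u) =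
    ext_ideal n f +>\<^bsub>exterior_algebra n\<^esub> (c \<odot>\<^bsub>exterior_algebra n\<^esub> u)"
proof -
  have "ext_ideal n f +>\<^bsub>exterior_algebra n\<^esub> (c \<odot>\<^bsub>exterior_algebra n\<^esub> v) =
      ext_ideal n f +>\<^bsub>exterior_algebra n\<^esub> (c \<odot>\<^bsub>exterior_algebra n\<^esub> u)"
    if "v \<in> ext_ideal n f +>\<^bsub>exterior_algebra n\<^esub> u" for v
  proof -
    from that obtain h where h: "h \<in> ext_ideal n f" "v = h \<oplus>\<^bsub>exterior_algebra n\<^esub> u"
      by (auto simp: a_r_coset_def')
    have hc: "h \<in> carrier (exterior_algebra n)" using h(1) by (rule I.a_Hcarr)
    have "c \<odot>\<^bsub>exterior_algebra n\<^esub> v =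
        c \<odot>\<^bsub>exterior_algebra n\<^esub> h \<oplus>\<^bsub>exterior_algebra n\<^esub> c \<odot>\<^bsub>exterior_algebra n\<^esub> u"
      unfolding h(2) using hc u by (intro E.smult_r_distr) auto
    then have "c \<odot>\<^bsub>exterior_algebra n\<^esub> v \<in>
        ext_ideal n f +>\<^bsub>exterior_algebra n\<^esub> (c \<odot>\<^bsub>exterior_algebra n\<^esub> u)"
      using ext_smult_ideal[OF h(1)] by (auto simp: a_r_coset_def')
    then show ?thesis
      using u by (intro E.a_repr_independence[symmetric] E.smult_closed I.a_subgroup) auto
  qed
  moreover have "u \<in> ext_ideal n f +>\<^bsub>exterior_algebra n\<^esub> u"
    using u by (rule I.a_rcos_self)
  ultimately show ?thesis
    unfolding ext_quotient_simps by (intro UN_constant_eq ballI)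
qed

lemma ext_quotient_carrier:
  "carrier (ext_quotient n f) = (\<lambda>u. ext_ideal n f +>\<^bsub>exterior_algebra n\<^esub> u) ` carrier (exterior_algebra n)"
  by (auto simp: ext_quotient_simps FactRing_def A_RCOSETS_def')

lemma ext_quotient_add_coset:
  assumes "u \<in> carrier (exterior_algebra n)" "v \<in> carrier (exterior_algebra n)"
  shows "(ext_ideal n f +>\<^bsub>exterior_algebra n\<^esub> u) \<oplus>\<^bsub>ext_quotient n f\<^esub> (ext_ideal n f +>\<^bsub>exterior_algebra n\<^esub> v) =
    ext_ideal n f +>\<^bsub>exterior_algebra n\<^esub> (u \<oplus>\<^bsub>exterior_algebra n\<^esub> v)"
  using assms by (simp add: ext_quotient_simps FactRing_def I.a_rcos_sum)

lemma ext_quotient_vectorspace: "vectorspace class_ring (ext_quotient n f)"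
proof -
  have R: "ring (exterior_algebra n Quot ext_ideal n f)"
    by (rule I.quotient_is_ring)
  have "abelian_group (ext_quotient n f)"
  proof -
    interpret Q: ring "exterior_algebra n Quot ext_ideal n f" by (rule R)
    show ?thesis
    proof (rule abelian_groupI)
      fix X assume "X \<in> carrier (ext_quotient n f)"
      then show "\<exists>Y\<in>carrier (ext_quotient n f).
          Y \<oplus>\<^bsub>ext_quotient n f\<^esub> X = \<zero>\<^bsub>ext_quotient n f\<^esub>"
        unfolding ext_quotient_simps using Q.l_neg Q.a_inv_closed by blast
    qed (simp_all add: ext_quotient_simps Q.add.m_ac)
  qed
  moreover have "cring (class_ring :: 'k ring)"
    by (rule class_cring.is_cring)
  ultimately have "Module.module class_ring (ext_quotient n f)"
  proof (intro moduleI)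
    fix c d :: 'k and X Y :: "(nat set \<Rightarrow> 'k) set"
    assume "X \<in> carrier (ext_quotient n f)"
    then obtain u where u: "u \<in> carrier (exterior_algebra n)"
      and X: "X = ext_ideal n f +>\<^bsub>exterior_algebra n\<^esub> u"
      by (auto simp: ext_quotient_carrier)
    have cu: "a \<odot>\<^bsub>exterior_algebra n\<^esub> u \<in> carrier (exterior_algebra n)" for a :: 'k
      using u by (intro E.smult_closed) auto
    show "c \<odot>\<^bsub>ext_quotient n f\<^esub> X \<in> carrier (ext_quotient n f)"
      unfolding X ext_quotient_smult_coset[OF u] ext_quotient_carrier using cu by (rule imageI)
    show "(c \<oplus>\<^bsub>class_ring\<^esub> d) \<odot>\<^bsub>ext_quotient n f\<^esub> X =
        c \<odot>\<^bsub>ext_quotient n f\<^esub> X \<oplus>\<^bsub>ext_quotient n f\<^esub> d \<odot>\<^bsub>ext_quotient n f\<^esub> X"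
      unfolding X ext_quotient_smult_coset[OF u] ext_quotient_add_coset[OF cu cu]
      by (subst E.smult_l_distr) (use u in auto)
    show "(c \<otimes>\<^bsub>class_ring\<^esub> d) \<odot>\<^bsub>ext_quotient n f\<^esub> X =
        c \<odot>\<^bsub>ext_quotient n f\<^esub> (d \<odot>\<^bsub>ext_quotient n f\<^esub> X)"
      unfolding X ext_quotient_smult_coset[OF u] ext_quotient_smult_coset[OF cu]
      by (subst E.smult_assoc1) (use u in auto)
    show "\<one>\<^bsub>class_ring\<^esub> \<odot>\<^bsub>ext_quotient n f\<^esub> X = X"
      unfolding X ext_quotient_smult_coset[OF u]
      by (subst E.smult_one) (use u in auto)
    assume "Y \<in> carrier (ext_quotient n f)"
    then obtain v where v: "v \<in> carrier (exterior_algebra n)"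
      and Y: "Y = ext_ideal n f +>\<^bsub>exterior_algebra n\<^esub> v"
      by (auto simp: ext_quotient_carrier)
    have cv: "c \<odot>\<^bsub>exterior_algebra n\<^esub> v \<in> carrier (exterior_algebra n)"
      using v by (intro E.smult_closed) auto
    have uv: "u \<oplus>\<^bsub>exterior_algebra n\<^esub> v \<in> carrier (exterior_algebra n)"
      using u v by (rule E.add.m_closed)
    show "c \<odot>\<^bsub>ext_quotient n f\<^esub> (X \<oplus>\<^bsub>ext_quotient n f\<^esub> Y) =
        c \<odot>\<^bsub>ext_quotient n f\<^esub> X \<oplus>\<^bsub>ext_quotient n f\<^esub> c \<odot>\<^bsub>ext_quotient n f\<^esub> Y"
      unfolding X Y ext_quotient_add_coset[OF u v] ext_quotient_smult_coset[OF u]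
        ext_quotient_smult_coset[OF v] ext_quotient_smult_coset[OF uv] ext_quotient_add_coset[OF cu cv]
      by (subst E.smult_r_distr) (use u v in auto)
  qed
  then show ?thesis
    by (intro vectorspace.intro class_field)
qed

lemma ext_quotient_degree_vectorspace: "vectorspace class_ring (ext_quotient_degree n f i)"
proof -
  interpret Q: vectorspace class_ring "ext_quotient n f"
    by (rule ext_quotient_vectorspace)
  show ?thesis
    unfolding ext_quotient_degree_def
  proof (rule Q.subspace_is_vs, rule subspace.intro)
    have "\<zero>\<^bsub>ext_quotient n f\<^esub> = ext_ideal n f +>\<^bsub>exterior_algebra n\<^esub> \<zero>\<^bsub>exterior_algebra n\<^esub>"
      using E.a_coset_add_zero[OF I.a_subset] by (simp add: ext_quotient_simps FactRing_def)
    moreover have "\<zero>\<^bsub>exterior_algebra n\<^esub> \<in> ext_degree n i"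
      by (simp add: exterior_algebra_def ext_degree_def)
    ultimately have "\<zero>\<^bsub>ext_quotient n f\<^esub> \<in>
        (\<lambda>u. ext_ideal n f +>\<^bsub>exterior_algebra n\<^esub> u) ` ext_degree n i"
      by (rule image_eqI)
    moreover have "u \<oplus>\<^bsub>exterior_algebra n\<^esub> v \<in> ext_degree n i"
      if "u \<in> ext_degree n i" "v \<in> ext_degree n i" for u v :: "nat set \<Rightarrow> 'k"
    proof -
      have "S \<in> squarefree_monomials n i" if "u S + v S \<noteq> 0" for S
      proof -
        from that have "u S \<noteq> 0 \<or> v S \<noteq> 0" by auto
        with \<open>u \<in> _\<close> \<open>v \<in> _\<close> show ?thesis by (auto simp: ext_degree_def)
      qed
      then show ?thesis by (simp add: exterior_algebra_def ext_degree_def)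
    qed
    moreover have "c \<odot>\<^bsub>exterior_algebra n\<^esub> u \<in> ext_degree n i"
      if "u \<in> ext_degree n i" for c and u :: "nat set \<Rightarrow> 'k"
      using that by (auto simp: exterior_algebra_def ext_degree_def)
    ultimately show "LinearCombinations.submodule class_ring
        ((\<lambda>u. ext_ideal n f +>\<^bsub>exterior_algebra n\<^esub> u) ` ext_degree n i) (ext_quotient n f)"
      using ext_degree_subset[of n i]
      by (intro LinearCombinations.submodule.intro Q.module_axioms)
        (auto simp: ext_quotient_carrier ext_quotient_smult_coset ext_quotient_add_coset subset_iff)
  qed (rule Q.vectorspace_axioms)
qed

end

end

theory Submission
  imports Defs
begin

text \<open>
  A form \<open>f\<close> of even degree \<open>d\<close> is central, so the ideal \<open>(f)\<close> meets the degree \<open>i\<close> part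
  \<open>\<Lambda>\<^sup>i\<close> of the exterior algebra in zero if \<open>i < d\<close> and otherwise in \<open>\<Lambda>\<^bsup>i-d\<^esup> f\<close>. The degree \<open>i\<close> part of the quotient therefore has
  dimension \<open>n choose i\<close> minus the rank of multiplication by \<open>f\<close>, as a map from \<open>\<Lambda>\<^bsup>i-d\<^esup>\<close> to \<open>\<Lambda>\<^sup>i\<close>.
  For generic \<open>f\<close> this rank is as large as possible: with \<open>j = i - d\<close>, the map is injective if
  \<open>2 j + d \<le> n\<close> (\<open>generic_mult_injective\<close>) and surjective if \<open>2 j + d \<ge> n\<close>
  (\<open>generic_mult_surjective\<close>). So the dimension is the larger of \<open>0\<close> and the coefficient of \<open>t\<^sup>i\<close> in
  \<open>(1 + t)\<^sup>n (1 - t\<^sup>d)\<close>. Once such a coefficient is non-positive, all later ones are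
  (\<open>expected_series_stays_nonpos\<close>), and replacing negative coefficients by \<open>0\<close> is the same as truncating.

  Maximal rank holds for generic \<open>f\<close> as soon as it holds for one form \<open>g\<close> with rational coefficients: it is the
  non-vanishing of a determinant that is a rational polynomial in the coefficients of the form, and
  such a polynomial vanishes at algebraically independent coefficients only if it is zero, in which case it
  vanishes at the coefficients of \<open>g\<close> too (\<open>specialization_injective\<close>, \<open>specialization_surjective\<close>).

  For \<open>d = 2 k\<close>, take \<open>g = \<omega>\<^sup>k / k!\<close>, where \<open>\<omega> = x\<^sub>1 x\<^sub>2 + x\<^sub>3 x\<^sub>4 + \<dots>\<close> is a form of maximal rank. Thus \<open>g\<close> is the
  sum of all products of \<open>k\<close> distinct pairs \<open>x\<^bsub>2c+1\<^esub> x\<^bsub>2c+2\<^esub>\<close>. Multiplying a monomial by such a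
  product gives zero or, without any sign, a monomial, since pairs are adjacent and even. It also does not change the set \<open>H\<close> of those
  indices of the monomial whose partner is missing. For fixed \<open>H\<close>, multiplication by
  \<open>g\<close> is the inclusion matrix of \<open>t\<close>-sets against \<open>(t + k)\<close>-sets of pairs disjoint from \<open>H\<close>,
  which is injective in the required range by a theorem of Gottlieb (\<open>inclusion_matrix_injective\<close>).
  Replacing every index set by its complement transposes the matrix of \<open>g\<close>; this turns
  injectivity in low degrees into surjectivity in high degrees.
\<close>

section \<open>Inclusion matrices of subsets\<close>

lemma card_subsets_between:
  assumes "finite B" "D \<subseteq> B"
  shows "card {W. D \<subseteq> W \<and> W \<subseteq> B \<and> card W = w} =
    (if card D \<le> w then (card B - card D) choose (w - card D) else 0)"
proof -
  have fin: "finite W" if "W \<subseteq> B" for W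
    using assms(1) that by (rule rev_finite_subset)
  show ?thesis
  proof (cases "card D \<le> w")
    case True
    have "bij_betw (\<lambda>W. W - D) {W. D \<subseteq> W \<and> W \<subseteq> B \<and> card W = w} {W. W \<subseteq> B - D \<and> card W = w - card D}"
    proof (rule bij_betw_byWitness[where f' = "\<lambda>W. W \<union> D"])
      show "(\<lambda>W. W - D) ` {W. D \<subseteq> W \<and> W \<subseteq> B \<and> card W = w} \<subseteq> {W. W \<subseteq> B - D \<and> card W = w - card D}"
        using fin assms by (auto simp: card_Diff_subset)
      show "(\<lambda>W. W \<union> D) ` {W. W \<subseteq> B - D \<and> card W = w - card D} \<subseteq> {W. D \<subseteq> W \<and> W \<subseteq> B \<and> card W = w}"
      proof safe
        fix W assume W: "W \<subseteq> B - D" "card W = w - card D"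
        then have "W \<inter> D = {}" "finite W" "finite D"
          using assms fin[of W] fin[of D] by auto
        then show "card (W \<union> D) = w"
          using True W by (simp add: card_Un_disjoint)
      qed (use assms in auto)
    qed auto
    then have "card {W. D \<subseteq> W \<and> W \<subseteq> B \<and> card W = w} = card {W. W \<subseteq> B - D \<and> card W = w - card D}"
      by (rule bij_betw_same_card)
    also have "\<dots> = card (B - D) choose (w - card D)"
      using assms by (intro n_subsets) auto
    finally show ?thesis
      using True assms fin[of D] by (simp add: card_Diff_subset)
  next
    case False
    then have none: "{W. D \<subseteq> W \<and> W \<subseteq> B \<and> card W = w} = {}"
      using fin by (auto dest: card_mono)
    show ?thesis using False unfolding none by simp
  qed
qed

text \<open>
  Gottlieb's theorem. Fix the target set \<open>A\<close> and, for \<open>X \<subseteq> A\<close>, let \<open>z X\<close> be the sum of \<open>\<phi>\<close> over the \<open>t\<close>-sets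
  that meet \<open>A\<close> exactly in \<open>X\<close>; then \<open>z A = \<phi> A\<close>. Adding up the hypotheses for all \<open>s\<close>-sets \<open>S\<close> with
  \<open>S \<inter> A = X\<close> gives a linear relation between the \<open>z Y\<close> with \<open>Y \<subseteq> X\<close>, because the number of such \<open>S\<close> above
  a given \<open>T\<close> depends only on the size of \<open>T \<inter> A\<close>. The coefficient of \<open>z X\<close> is a binomial coefficient that is
  positive by \<open>t + s \<le> card F\<close>, so the system is triangular with non-zero diagonal.
\<close>
lemma inclusion_matrix_injective:
  fixes \<phi> :: "'a set \<Rightarrow> 'k::field_char_0"
  assumes F: "finite F" and ts: "t \<le> s" "t + s \<le> card F"
    and zero: "\<And>S. S \<subseteq> F \<Longrightarrow> card S = s \<Longrightarrow> (\<Sum>T | T \<subseteq> S \<and> card T = t. \<phi> T) = 0"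
    and A: "A \<subseteq> F" "card A = t"
  shows "\<phi> A = 0"
proof -
  have fin: "finite X" if "X \<subseteq> F" for X
    using F that by (rule rev_finite_subset)
  define z where "z X = (\<Sum>T | T \<subseteq> F \<and> card T = t \<and> T \<inter> A = X. \<phi> T)" for X
  have "z X = 0" if "finite X" "X \<subseteq> A" for X
    using that
  proof (induction X rule: finite_psubset_induct)
    case (psubset X)
    have X: "X \<subseteq> F" "card X \<le> t"
      using psubset.prems A fin[OF A(1)] card_mono[of A X] by auto
    define \<S> where "\<S> = {S. S \<subseteq> F \<and> card S = s \<and> S \<inter> A = X}"
    define \<T> where "\<T> = {T. T \<subseteq> F \<and> card T = t \<and> T \<inter> A \<subseteq> X}"
    define N where "N T = card {S \<in> \<S>. T \<subseteq> S}" for T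
    have finST: "finite \<S>" "finite \<T>"
      using F unfolding \<S>_def \<T>_def by simp_all
    \<comment> \<open>Removing \<open>A\<close> turns the sets counted by \<open>N T\<close> into the sets between \<open>T - A\<close> and \<open>F - A\<close>.\<close>
    have N: "N T = (if t - card (T \<inter> A) \<le> s - card X
        then (card F - t - (t - card (T \<inter> A))) choose (s - card X - (t - card (T \<inter> A))) else 0)"
      if "T \<in> \<T>" for T
    proof -
      from that have T: "T \<subseteq> F" "card T = t" "T \<inter> A \<subseteq> X" by (auto simp: \<T>_def)
      have cTA: "card (T - A) = t - card (T \<inter> A)"
        using T fin[OF T(1)] by (simp add: card_Diff_subset_Int)
      have "bij_betw (\<lambda>S. S - A) {S \<in> \<S>. T \<subseteq> S} {W. T - A \<subseteq> W \<and> W \<subseteq> F - A \<and> card W = s - card X}"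
      proof (rule bij_betw_byWitness[where f' = "\<lambda>W. W \<union> X"])
        show "(\<lambda>S. S - A) ` {S \<in> \<S>. T \<subseteq> S} \<subseteq> {W. T - A \<subseteq> W \<and> W \<subseteq> F - A \<and> card W = s - card X}"
          using fin A by (auto simp: \<S>_def card_Diff_subset_Int)
        show "(\<lambda>W. W \<union> X) ` {W. T - A \<subseteq> W \<and> W \<subseteq> F - A \<and> card W = s - card X} \<subseteq> {S \<in> \<S>. T \<subseteq> S}"
        proof safe
          fix W assume W: "T - A \<subseteq> W" "W \<subseteq> F - A" "card W = s - card X"
          have "W \<inter> X = {}" "finite W" "finite X"
            using W psubset.prems fin[of W] fin[OF X(1)] by auto
          then have "card (W \<union> X) = s"
            using W(3) X(2) ts by (simp add: card_Un_disjoint)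
          then show "W \<union> X \<in> \<S>"
            using W psubset.prems A by (auto simp: \<S>_def)
          fix a assume "a \<in> T" "a \<notin> X" then show "a \<in> W" using W T by auto
        qed
      qed (use psubset.prems in \<open>auto simp: \<S>_def\<close>)
      then have "N T = card {W. T - A \<subseteq> W \<and> W \<subseteq> F - A \<and> card W = s - card X}"
        unfolding N_def by (rule bij_betw_same_card)
      then show ?thesis
        using card_subsets_between[of "F - A" "T - A" "s - card X"] T F A fin[OF A(1)] cTA
        by (simp add: card_Diff_subset Diff_mono)
    qed
    have "0 = (\<Sum>S\<in>\<S>. \<Sum>T | T \<subseteq> S \<and> card T = t. \<phi> T)"
      using zero by (simp add: \<S>_def)
    also have "\<dots> = (\<Sum>S\<in>\<S>. \<Sum>T \<in> {T \<in> \<T>. T \<subseteq> S}. \<phi> T)"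
      by (intro sum.cong refl) (auto simp: \<S>_def \<T>_def)
    also have "\<dots> = (\<Sum>T\<in>\<T>. \<Sum>S \<in> {S \<in> \<S>. T \<subseteq> S}. \<phi> T)"
      using finST by (rule sum.swap_restrict)
    also have "\<dots> = (\<Sum>T\<in>\<T>. of_nat (N T) * \<phi> T)"
      by (simp add: N_def)
    also have "\<dots> = (\<Sum>Y\<in>Pow X. \<Sum>T \<in> {T \<in> \<T>. T \<inter> A = Y}. of_nat (N T) * \<phi> T)"
      using finST X fin by (intro sum.group[symmetric]) (auto simp: \<T>_def)
    also have "\<dots> = (\<Sum>Y\<in>Pow X. if Y = X then of_nat ((card F - 2 * t + card X) choose (s - t)) * z X else 0)"
    proof (intro sum.cong refl)
      fix Y assume Y: "Y \<in> Pow X"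
      define c where "c = (if t - card Y \<le> s - card X
        then (card F - t - (t - card Y)) choose (s - card X - (t - card Y)) else 0)"
      have "(\<Sum>T \<in> {T \<in> \<T>. T \<inter> A = Y}. of_nat (N T) * \<phi> T) = (\<Sum>T \<in> {T \<in> \<T>. T \<inter> A = Y}. of_nat c * \<phi> T)"
        by (intro sum.cong refl) (auto simp: N c_def)
      also have "\<dots> = of_nat c * z Y"
        unfolding z_def sum_distrib_left using Y by (intro sum.cong) (auto simp: \<T>_def)
      finally have *: "(\<Sum>T \<in> {T \<in> \<T>. T \<inter> A = Y}. of_nat (N T) * \<phi> T) = of_nat c * z Y" .
      show "(\<Sum>T \<in> {T \<in> \<T>. T \<inter> A = Y}. of_nat (N T) * \<phi> T) =
        (if Y = X then of_nat ((card F - 2 * t + card X) choose (s - t)) * z X else 0)"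
      proof (cases "Y = X")
        case True
        have "c = (card F - 2 * t + card X) choose (s - t)"
          using X ts unfolding c_def True by (auto simp: mult_2)
        then show ?thesis using * True by simp
      next
        case False
        then have "z Y = 0" using Y psubset by auto
        then show ?thesis using * False by simp
      qed
    qed
    also have "\<dots> = of_nat ((card F - 2 * t + card X) choose (s - t)) * z X"
      using fin[OF X(1)] by simp
    finally show "z X = 0"
      using ts by (auto simp: binomial_eq_0_iff)
  qed
  then have "z A = 0" using fin[OF A(1)] by simp
  moreover have "{T. T \<subseteq> F \<and> card T = t \<and> T \<inter> A = A} = {A}"
    using A fin by (auto simp: Int_absorb1 dest: card_subset_eq[rotated])
      (metis card_subset_eq inf_commute inf_le1 subsetD)+
  ultimately show ?thesis by (simp add: z_def)
qed

section \<open>Specialization of algebraically independent elements\<close>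

text \<open>
  \<open>poly_eval\<close> evaluates polynomials with rational coefficients in the same encoding as in
  \<^const>\<open>alg_independent_rat\<close>, at points of an arbitrary field of characteristic \<open>0\<close>; both
  the given field and \<open>rat\<close> itself occur as targets.
\<close>
definition monomial_eval :: "('a \<Rightarrow> 'b) \<Rightarrow> ('a \<Rightarrow>\<^sub>0 nat) \<Rightarrow> 'b::field_char_0" where
  "monomial_eval h m = (\<Prod>a\<in>Poly_Mapping.keys m. h a ^ Poly_Mapping.lookup m a)"

definition poly_eval :: "('a \<Rightarrow> 'b) \<Rightarrow> (('a \<Rightarrow>\<^sub>0 nat) \<Rightarrow>\<^sub>0 rat) \<Rightarrow> 'b::field_char_0" where
  "poly_eval h p = (\<Sum>m\<in>Poly_Mapping.keys p. of_rat (Poly_Mapping.lookup p m) * monomial_eval h m)"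

lemma monomial_eval_superset:
  assumes "finite X" "Poly_Mapping.keys m \<subseteq> X"
  shows "monomial_eval h m = (\<Prod>a\<in>X. h a ^ Poly_Mapping.lookup m a)"
  unfolding monomial_eval_def using assms
  by (intro prod.mono_neutral_left) (auto simp: in_keys_iff)

lemma poly_eval_superset:
  assumes "finite X" "Poly_Mapping.keys p \<subseteq> X"
  shows "poly_eval h p = (\<Sum>m\<in>X. of_rat (Poly_Mapping.lookup p m) * monomial_eval h m)"
  unfolding poly_eval_def using assms
  by (intro sum.mono_neutral_left) (auto simp: in_keys_iff)

lemma monomial_eval_add: "monomial_eval h (m + m') = monomial_eval h m * monomial_eval h m'"
proof -
  let ?X = "Poly_Mapping.keys m \<union> Poly_Mapping.keys m'"
  have "monomial_eval h (m + m') = (\<Prod>a\<in>?X. h a ^ Poly_Mapping.lookup (m + m') a)"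
    using Poly_Mapping.keys_add[of m m'] by (intro monomial_eval_superset) auto
  then show ?thesis
    by (simp add: monomial_eval_superset[of ?X] lookup_add power_add prod.distrib)
qed

lemma poly_eval_0 [simp]: "poly_eval h 0 = 0"
  by (simp add: poly_eval_def)

lemma poly_eval_add: "poly_eval h (p + q) = poly_eval h p + poly_eval h q"
proof -
  let ?X = "Poly_Mapping.keys p \<union> Poly_Mapping.keys q"
  have "poly_eval h (p + q) = (\<Sum>m\<in>?X. of_rat (Poly_Mapping.lookup (p + q) m) * monomial_eval h m)"
    using Poly_Mapping.keys_add[of p q] by (intro poly_eval_superset) auto
  then show ?thesis
    by (simp add: poly_eval_superset[of ?X] lookup_add of_rat_add distrib_right sum.distrib)
qed

lemma poly_eval_sum: "poly_eval h (\<Sum>i\<in>I. p i) = (\<Sum>i\<in>I. poly_eval h (p i))"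
  by (induction I rule: infinite_finite_induct) (simp_all add: poly_eval_add)

lemma poly_eval_single: "poly_eval h (Poly_Mapping.single m c) = of_rat c * monomial_eval h m"
  by (simp add: poly_eval_superset[of "{m}"])

lemma sum_single_lookup: "(\<Sum>m\<in>Poly_Mapping.keys p. Poly_Mapping.single m (Poly_Mapping.lookup p m)) = p"
proof (rule poly_mapping_eqI)
  fix k
  have "Poly_Mapping.lookup (\<Sum>m\<in>Poly_Mapping.keys p. Poly_Mapping.single m (Poly_Mapping.lookup p m)) k =
    (\<Sum>m\<in>Poly_Mapping.keys p. if m = k then Poly_Mapping.lookup p k else 0)"
    unfolding lookup_sum by (intro sum.cong) (auto simp: lookup_single when_def)
  then show "Poly_Mapping.lookup (\<Sum>m\<in>Poly_Mapping.keys p. Poly_Mapping.single m (Poly_Mapping.lookup p m)) k =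
    Poly_Mapping.lookup p k"
    by (simp add: in_keys_iff)
qed

lemma poly_eval_mult: "poly_eval h (p * q) = poly_eval h p * poly_eval h q"
proof -
  have "p * q = (\<Sum>m\<in>Poly_Mapping.keys p. \<Sum>m'\<in>Poly_Mapping.keys q.
      Poly_Mapping.single (m + m') (Poly_Mapping.lookup p m * Poly_Mapping.lookup q m'))"
    by (subst (1 2) sum_single_lookup[symmetric]) (simp only: sum_product mult_single)
  then have "poly_eval h (p * q) = (\<Sum>m\<in>Poly_Mapping.keys p. \<Sum>m'\<in>Poly_Mapping.keys q.
      (of_rat (Poly_Mapping.lookup p m) * monomial_eval h m) *
      (of_rat (Poly_Mapping.lookup q m') * monomial_eval h m'))"
    by (simp add: poly_eval_sum poly_eval_single monomial_eval_add of_rat_mult mult_ac)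
  then show ?thesis
    by (simp add: poly_eval_def sum_product)
qed

text \<open>
  The graph of the substitution \<open>a \<mapsto> h a\<close> on the ring generated by \<open>A\<close> over the rationals: both values
  come from one polynomial. It is closed under the ring operations for any \<open>A\<close>, but only for
  algebraically independent \<open>A\<close> is it the graph of a function, hence a ring homomorphism.
\<close>
definition specializes :: "'k set \<Rightarrow> ('k \<Rightarrow> rat) \<Rightarrow> 'k::field_char_0 \<Rightarrow> rat \<Rightarrow> bool" where
  "specializes A h y r \<longleftrightarrow> (\<exists>p. (\<forall>m\<in>Poly_Mapping.keys p. Poly_Mapping.keys m \<subseteq> A) \<and>
     y = poly_eval (\<lambda>a. a) p \<and> r = poly_eval h p)"

lemma specializes_of_rat: "specializes A h (of_rat q) q"
  unfolding specializes_def
  by (rule exI[of _ "Poly_Mapping.single 0 q"]) (auto simp: poly_eval_single monomial_eval_def)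

lemma specializes_var: "a \<in> A \<Longrightarrow> specializes A h a (h a)"
  unfolding specializes_def
  by (rule exI[of _ "Poly_Mapping.single (Poly_Mapping.single a 1) 1"])
    (auto simp: poly_eval_single monomial_eval_def)

lemma specializes_add:
  assumes "specializes A h y r" "specializes A h y' r'"
  shows "specializes A h (y + y') (r + r')"
proof -
  from assms obtain p q where
    "\<forall>m\<in>Poly_Mapping.keys p. Poly_Mapping.keys m \<subseteq> A" "y = poly_eval (\<lambda>a. a) p" "r = poly_eval h p"
    "\<forall>m\<in>Poly_Mapping.keys q. Poly_Mapping.keys m \<subseteq> A" "y' = poly_eval (\<lambda>a. a) q" "r' = poly_eval h q"
    unfolding specializes_def by blast
  then show ?thesis
    unfolding specializes_def using Poly_Mapping.keys_add[of p q]
    by (intro exI[of _ "p + q"]) (auto simp: poly_eval_add)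
qed

lemma specializes_mult:
  assumes "specializes A h y r" "specializes A h y' r'"
  shows "specializes A h (y * y') (r * r')"
proof -
  from assms obtain p q where
    pq: "\<forall>m\<in>Poly_Mapping.keys p. Poly_Mapping.keys m \<subseteq> A" "y = poly_eval (\<lambda>a. a) p" "r = poly_eval h p"
    "\<forall>m\<in>Poly_Mapping.keys q. Poly_Mapping.keys m \<subseteq> A" "y' = poly_eval (\<lambda>a. a) q" "r' = poly_eval h q"
    unfolding specializes_def by blast
  have "Poly_Mapping.keys m \<subseteq> A" if "m \<in> Poly_Mapping.keys (p * q)" for m
  proof -
    from that keys_mult[of p q] obtain a b where "m = a + b" "a \<in> Poly_Mapping.keys p" "b \<in> Poly_Mapping.keys q"
      by blast
    then show ?thesis using pq Poly_Mapping.keys_add[of a b] by blast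
  qed
  then show ?thesis
    unfolding specializes_def using pq
    by (intro exI[of _ "p * q"]) (auto simp: poly_eval_mult)
qed

lemma specializes_sum:
  "(\<And>i. i \<in> I \<Longrightarrow> specializes A h (y i) (r i)) \<Longrightarrow> specializes A h (\<Sum>i\<in>I. y i) (\<Sum>i\<in>I. r i)"
  using specializes_of_rat[of A h 0]
  by (induction I rule: infinite_finite_induct) (auto intro: specializes_add)

lemma specializes_prod:
  "(\<And>i. i \<in> I \<Longrightarrow> specializes A h (y i) (r i)) \<Longrightarrow> specializes A h (\<Prod>i\<in>I. y i) (\<Prod>i\<in>I. r i)"
  using specializes_of_rat[of A h 1]
  by (induction I rule: infinite_finite_induct) (auto intro: specializes_mult)

text \<open>
  The only polynomial that represents \<open>0\<close> at algebraically independent elements is zero. This is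
  what makes substitution a well-defined map.
\<close>
lemma specializes_0:
  assumes "alg_independent_rat A" "specializes A h 0 r"
  shows "r = 0"
proof -
  from assms(2) obtain p where p: "\<forall>m\<in>Poly_Mapping.keys p. Poly_Mapping.keys m \<subseteq> A"
    "poly_eval (\<lambda>a. a) p = 0" "r = poly_eval h p"
    unfolding specializes_def by metis
  then have "p = 0"
    using assms(1) unfolding alg_independent_rat_def poly_eval_def monomial_eval_def by blast
  with p show ?thesis by simp
qed

lemma specializes_det:
  assumes "\<And>i j. i < N \<Longrightarrow> j < N \<Longrightarrow> specializes A h (Q $$ (i, j)) (G $$ (i, j))"
    and "Q \<in> carrier_mat N N" "G \<in> carrier_mat N N"
  shows "specializes A h (det Q) (det G)"
  unfolding det_def'[OF assms(2)] det_def'[OF assms(3)]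
proof (intro specializes_sum specializes_mult specializes_prod)
  fix p assume "p \<in> {p. p permutes {0..<N}}"
  show "specializes A h (of_int (sign p)) (of_int (sign p))"
    using specializes_of_rat[of A h "of_int (sign p)"] by simp
  fix i assume "i \<in> {0..<N}"
  then show "specializes A h (Q $$ (i, p i)) (G $$ (i, p i))"
    using assms(1) \<open>p \<in> _\<close> permutes_in_image[of p "{0..<N}" i] by auto
qed

section \<open>Maximal rank under specialization\<close>

text \<open>
  The enumeration \<open>e\<close> of a finite index set carries families indexed by that set over to matrices with
  indices below \<open>N\<close>, for which there are determinants.
\<close>
definition family_mat :: "(nat \<Rightarrow> 'a) \<Rightarrow> nat \<Rightarrow> ('a \<Rightarrow> 'a \<Rightarrow> 'k) \<Rightarrow> 'k mat" where
  "family_mat e N Q = mat N N (\<lambda>(i, j). Q (e i) (e j))"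

lemma family_mat_carrier [simp]: "family_mat e N Q \<in> carrier_mat N N"
  by (simp add: family_mat_def)

lemma family_mat_mult_vec:
  fixes Q :: "'a \<Rightarrow> 'a \<Rightarrow> 'k::comm_ring_1"
  assumes "bij_betw e {0..<N} I" "i < N" "v \<in> carrier_vec N" "\<And>j. j < N \<Longrightarrow> x (e j) = v $ j"
  shows "(family_mat e N Q *\<^sub>v v) $ i = (\<Sum>b\<in>I. Q (e i) b * x b)"
proof -
  have "(family_mat e N Q *\<^sub>v v) $ i = (\<Sum>j = 0..<N. Q (e i) (e j) * x (e j))"
    using assms(2-) by (simp add: family_mat_def scalar_prod_def)
  also have "\<dots> = (\<Sum>b\<in>I. Q (e i) b * x b)"
    using assms(1) by (rule sum.reindex_bij_betw)
  finally show ?thesis .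
qed

lemma det_family_mat_eq_0_iff:
  fixes Q :: "'a \<Rightarrow> 'a \<Rightarrow> 'k::field"
  assumes e: "bij_betw e {0..<N} I"
  shows "det (family_mat e N Q) \<noteq> 0 \<longleftrightarrow>
    (\<forall>x. (\<forall>a\<in>I. (\<Sum>b\<in>I. Q a b * x b) = 0) \<longrightarrow> (\<forall>b\<in>I. x b = 0))" (is "_ \<longleftrightarrow> ?inj")
proof -
  have img: "e ` {0..<N} = I" using e by (simp add: bij_betw_def)
  have inv: "inv_into {0..<N} e (e i) = i" if "i < N" for i
    using e that by (simp add: bij_betw_def)
  have "det (family_mat e N Q) = 0 \<longleftrightarrow> \<not> ?inj"
    unfolding det_0_iff_vec_prod_zero_field[OF family_mat_carrier]
  proof
    assume "\<exists>v. v \<in> carrier_vec N \<and> v \<noteq> 0\<^sub>v N \<and> family_mat e N Q *\<^sub>v v = 0\<^sub>v N"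
    then obtain v where v: "v \<in> carrier_vec N" "v \<noteq> 0\<^sub>v N" "family_mat e N Q *\<^sub>v v = 0\<^sub>v N" by blast
    define x where "x b = v $ inv_into {0..<N} e b" for b
    have "(\<Sum>b\<in>I. Q a b * x b) = 0" if "a \<in> I" for a
    proof -
      from that img obtain i where i: "i < N" "a = e i" by force
      have "(\<Sum>b\<in>I. Q (e i) b * x b) = (family_mat e N Q *\<^sub>v v) $ i"
        using family_mat_mult_vec[OF e i(1) v(1), of x Q] inv by (simp add: x_def)
      then show ?thesis using v i by simp
    qed
    moreover obtain j where j: "j < N" "v $ j \<noteq> 0"
      using v(1,2) by (metis carrier_vecD eq_vecI index_zero_vec)
    then have "x (e j) \<noteq> 0" "e j \<in> I"
      using inv img by (auto simp: x_def)
    ultimately show "\<not> ?inj" by blast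
  next
    assume "\<not> ?inj"
    then obtain x b where x: "\<forall>a\<in>I. (\<Sum>b\<in>I. Q a b * x b) = 0" "b \<in> I" "x b \<noteq> 0" by blast
    define v where "v = vec N (\<lambda>j. x (e j))"
    have v: "v \<in> carrier_vec N" by (simp add: v_def)
    have "(family_mat e N Q *\<^sub>v v) $ i = 0" if "i < N" for i
    proof -
      have "(family_mat e N Q *\<^sub>v v) $ i = (\<Sum>b\<in>I. Q (e i) b * x b)"
        using family_mat_mult_vec[OF e that v, of x Q] by (simp add: v_def)
      then show ?thesis using x(1) img that by force
    qed
    then have "family_mat e N Q *\<^sub>v v = 0\<^sub>v N"
      by (intro eq_vecI) (simp_all add: family_mat_def)
    moreover obtain j where "j < N" "b = e j" using x(2) img by force
    then have "v \<noteq> 0\<^sub>v N" using x(3) by (metis index_vec index_zero_vec(1) v_def)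
    ultimately show "\<exists>v. v \<in> carrier_vec N \<and> v \<noteq> 0\<^sub>v N \<and> family_mat e N Q *\<^sub>v v = 0\<^sub>v N"
      using v by blast
  qed
  then show ?thesis by blast
qed

lemma det_family_mat_imp_surj:
  fixes Q :: "'a \<Rightarrow> 'a \<Rightarrow> 'k::field"
  assumes e: "bij_betw e {0..<N} I" and det: "det (family_mat e N Q) \<noteq> 0"
  shows "\<exists>x. \<forall>a\<in>I. (\<Sum>b\<in>I. Q a b * x b) = y a"
proof -
  have img: "e ` {0..<N} = I" using e by (simp add: bij_betw_def)
  have inv: "inv_into {0..<N} e (e i) = i" if "i < N" for i
    using e that by (simp add: bij_betw_def)
  obtain B where B: "B \<in> carrier_mat N N" "family_mat e N Q * B = 1\<^sub>m N"
    using det_non_zero_imp_unit[OF family_mat_carrier det]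
    unfolding Units_def ring_mat_def by auto
  define w where "w = vec N (\<lambda>i. y (e i))"
  define v where "v = B *\<^sub>v w"
  define x where "x b = v $ inv_into {0..<N} e b" for b
  have v: "v \<in> carrier_vec N" using B by (simp add: v_def w_def)
  have Qv: "family_mat e N Q *\<^sub>v v = w"
    unfolding v_def using assoc_mult_mat_vec[OF family_mat_carrier B(1), of w e Q, symmetric] B(2)
    by (simp add: w_def)
  have "(\<Sum>b\<in>I. Q a b * x b) = y a" if "a \<in> I" for a
  proof -
    from that img obtain i where i: "i < N" "a = e i" by force
    have "(\<Sum>b\<in>I. Q (e i) b * x b) = (family_mat e N Q *\<^sub>v v) $ i"
      using family_mat_mult_vec[OF e i(1) v, of x Q] inv by (simp add: x_def)
    then show ?thesis using i by (simp add: Qv w_def)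
  qed
  then show ?thesis by blast
qed

text \<open>
  If \<open>G\<close> is injective then so is \<open>G\<^sup>T G\<close>, because \<open>x\<^sup>T G\<^sup>T G x\<close> is the sum of the squares of the entries
  of \<open>G x\<close>. The argument needs an ordered field, which is why \<open>G\<close> is rational.
\<close>
lemma gram_injective:
  fixes G :: "'a \<Rightarrow> 'b \<Rightarrow> rat"
  assumes fin: "finite I" "finite J"
    and inj: "\<And>x. (\<forall>a\<in>I. (\<Sum>b\<in>J. G a b * x b) = 0) \<Longrightarrow> \<forall>b\<in>J. x b = 0"
    and gram: "\<forall>b\<in>J. (\<Sum>b'\<in>J. (\<Sum>a\<in>I. G a b * G a b') * x b') = 0"
  shows "\<forall>b\<in>J. x b = 0"
proof (rule inj)
  have "(\<Sum>a\<in>I. (\<Sum>b\<in>J. G a b * x b)\<^sup>2) = (\<Sum>a\<in>I. \<Sum>b\<in>J. \<Sum>b'\<in>J. x b * (G a b * G a b' * x b'))"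
    by (simp add: power2_eq_square sum_product mult_ac)
  also have "\<dots> = (\<Sum>b\<in>J. \<Sum>a\<in>I. \<Sum>b'\<in>J. x b * (G a b * G a b' * x b'))"
    by (rule sum.swap)
  also have "\<dots> = (\<Sum>b\<in>J. \<Sum>b'\<in>J. \<Sum>a\<in>I. x b * (G a b * G a b' * x b'))"
    by (intro sum.cong refl sum.swap)
  also have "\<dots> = (\<Sum>b\<in>J. x b * (\<Sum>b'\<in>J. (\<Sum>a\<in>I. G a b * G a b') * x b'))"
    by (simp add: sum_distrib_left sum_distrib_right mult_ac)
  also have "\<dots> = 0"
    using gram by simp
  finally show "\<forall>a\<in>I. (\<Sum>b\<in>J. G a b * x b) = 0"
    using fin by (simp add: sum_nonneg_eq_0_iff)
qed

text \<open>
  The square matrix \<open>G\<^sup>T M\<close> specializes to \<open>G\<^sup>T G\<close>, whose determinant is non-zero; so the determinant of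
  \<open>G\<^sup>T M\<close> is non-zero, and \<open>M\<close> is injective.
\<close>
lemma specialization_injective:
  fixes M :: "'a \<Rightarrow> 'b \<Rightarrow> 'k::field_char_0"
  assumes fin: "finite I" "finite J" and A: "alg_independent_rat A"
    and spec: "\<And>a b. a \<in> I \<Longrightarrow> b \<in> J \<Longrightarrow> specializes A h (M a b) (G a b)"
    and inj: "\<And>x. (\<forall>a\<in>I. (\<Sum>b\<in>J. G a b * x b) = 0) \<Longrightarrow> \<forall>b\<in>J. x b = 0"
    and zero: "\<forall>a\<in>I. (\<Sum>b\<in>J. M a b * x b) = 0"
  shows "\<forall>b\<in>J. x b = 0"
proof -
  obtain e where e: "bij_betw e {0..<card J} J"
    using ex_bij_betw_nat_finite[OF fin(2)] by blast
  define Q where "Q b b' = (\<Sum>a\<in>I. of_rat (G a b) * M a b')" for b b'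
  define R where "R b b' = (\<Sum>a\<in>I. G a b * G a b')" for b b'
  have "specializes A h (det (family_mat e (card J) Q)) (det (family_mat e (card J) R))"
    using bij_betwE[OF e]
    by (intro specializes_det[where N = "card J"])
      (auto simp: family_mat_def Q_def R_def intro!: specializes_sum specializes_mult specializes_of_rat spec)
  moreover have "det (family_mat e (card J) R) \<noteq> 0"
    unfolding det_family_mat_eq_0_iff[OF e] R_def using gram_injective[OF fin inj] by blast
  ultimately have "det (family_mat e (card J) Q) \<noteq> 0"
    using specializes_0[OF A] by metis
  moreover have "(\<Sum>b'\<in>J. Q b b' * x b') = 0" for b
  proof -
    have "(\<Sum>b'\<in>J. Q b b' * x b') = (\<Sum>b'\<in>J. \<Sum>a\<in>I. of_rat (G a b) * (M a b' * x b'))"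
      by (simp add: Q_def sum_distrib_right sum_distrib_left mult_ac)
    also have "\<dots> = (\<Sum>a\<in>I. of_rat (G a b) * (\<Sum>b'\<in>J. M a b' * x b'))"
      by (subst sum.swap) (simp add: sum_distrib_left)
    finally show ?thesis using zero by simp
  qed
  ultimately show ?thesis
    unfolding det_family_mat_eq_0_iff[OF e] by blast
qed

text \<open>
  The same argument with \<open>M G\<^sup>T\<close> in place of \<open>G\<^sup>T M\<close>: when its determinant is non-zero, \<open>M\<close> is surjective.
\<close>
lemma specialization_surjective:
  fixes M :: "'a \<Rightarrow> 'b \<Rightarrow> 'k::field_char_0"
  assumes fin: "finite I" "finite J" and A: "alg_independent_rat A"
    and spec: "\<And>a b. a \<in> I \<Longrightarrow> b \<in> J \<Longrightarrow> specializes A h (M a b) (G a b)"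
    and inj: "\<And>y. (\<forall>b\<in>J. (\<Sum>a\<in>I. G a b * y a) = 0) \<Longrightarrow> \<forall>a\<in>I. y a = 0"
  shows "\<exists>x. \<forall>a\<in>I. (\<Sum>b\<in>J. M a b * x b) = y a"
proof -
  obtain e where e: "bij_betw e {0..<card I} I"
    using ex_bij_betw_nat_finite[OF fin(1)] by blast
  define Q where "Q a a' = (\<Sum>b\<in>J. M a b * of_rat (G a' b))" for a a'
  define R where "R a a' = (\<Sum>b\<in>J. G a b * G a' b)" for a a'
  have "specializes A h (det (family_mat e (card I) Q)) (det (family_mat e (card I) R))"
    using bij_betwE[OF e]
    by (intro specializes_det[where N = "card I"])
      (auto simp: family_mat_def Q_def R_def intro!: specializes_sum specializes_mult specializes_of_rat spec)
  moreover have "det (family_mat e (card I) R) \<noteq> 0"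
    unfolding det_family_mat_eq_0_iff[OF e] R_def
    using gram_injective[OF fin(2,1), of "\<lambda>b a. G a b"] inj by blast
  ultimately have "det (family_mat e (card I) Q) \<noteq> 0"
    using specializes_0[OF A] by metis
  then obtain w where w: "\<forall>a\<in>I. (\<Sum>a'\<in>I. Q a a' * w a') = y a"
    using det_family_mat_imp_surj[OF e] by blast
  have "(\<Sum>b\<in>J. M a b * (\<Sum>a'\<in>I. of_rat (G a' b) * w a')) = (\<Sum>a'\<in>I. Q a a' * w a')" for a
  proof -
    have "(\<Sum>b\<in>J. M a b * (\<Sum>a'\<in>I. of_rat (G a' b) * w a')) =
        (\<Sum>b\<in>J. \<Sum>a'\<in>I. M a b * of_rat (G a' b) * w a')"
      by (simp add: sum_distrib_left mult_ac)
    also have "\<dots> = (\<Sum>a'\<in>I. Q a a' * w a')"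
      unfolding Q_def sum_distrib_right by (rule sum.swap)
    finally show ?thesis .
  qed
  with w show ?thesis
    by (intro exI[of _ "\<lambda>b. \<Sum>a'\<in>I. of_rat (G a' b) * w a'"]) simp
qed

section \<open>A rational form of maximal rank\<close>

text \<open>
  The union of the pairs \<open>{2 c + 1, 2 c + 2}\<close> with \<open>c \<in> T\<close>. Written as a preimage under \<open>x \<mapsto> (x - 1) div 2\<close>,
  it visibly commutes with unions, intersections and differences. The pairs inside \<open>{1..n}\<close> are those with \<open>c < n div 2\<close>.
\<close>
definition pair_union :: "nat set \<Rightarrow> nat set" where
  "pair_union T = {x. 0 < x \<and> (x - 1) div 2 \<in> T}"

lemma mem_pair_union_pair [simp]:
  "Suc (2 * c) \<in> pair_union T \<longleftrightarrow> c \<in> T" "Suc (Suc (2 * c)) \<in> pair_union T \<longleftrightarrow> c \<in> T"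
  by (simp_all add: pair_union_def)

lemma pair_union_conv_image:
  "pair_union T = (\<lambda>c. Suc (2 * c)) ` T \<union> (\<lambda>c. Suc (Suc (2 * c))) ` T"
proof (intro equalityI subsetI)
  fix x assume x: "x \<in> pair_union T"
  define c where "c = (x - 1) div 2"
  have "c \<in> T" "x = Suc (2 * c) \<or> x = Suc (Suc (2 * c))"
    using x unfolding pair_union_def c_def by (auto; presburger)+
  then show "x \<in> (\<lambda>c. Suc (2 * c)) ` T \<union> (\<lambda>c. Suc (Suc (2 * c))) ` T" by blast
qed auto

lemma pair_union_empty [simp]: "pair_union {} = {}"
  and pair_union_Diff: "pair_union (T - R) = pair_union T - pair_union R"
  and pair_union_mono: "T \<subseteq> R \<Longrightarrow> pair_union T \<subseteq> pair_union R"
  and pair_union_insert: "pair_union (insert c T) = {Suc (2 * c), Suc (Suc (2 * c))} \<union> pair_union T"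
proof -
  show "pair_union (insert c T) = {Suc (2 * c), Suc (Suc (2 * c))} \<union> pair_union T"
    unfolding pair_union_conv_image by auto
qed (auto simp: pair_union_def)

lemma finite_pair_union [simp]: "finite T \<Longrightarrow> finite (pair_union T)"
  by (simp add: pair_union_conv_image)

lemma card_pair_union: "finite T \<Longrightarrow> card (pair_union T) = 2 * card T"
  by (induction T rule: finite_induct) (simp_all add: pair_union_insert)

lemma pair_union_subset: "T \<subseteq> {..<n div 2} \<Longrightarrow> pair_union T \<subseteq> {1..n}"
  unfolding pair_union_conv_image by force

text \<open>
  No index outside a pair lies between its two members, so every index of \<open>A\<close> is involved in
  none or two inversions with each pair.
\<close>
lemma merge_sign_pair_union:
  assumes "finite A" "finite T" "A \<inter> pair_union T = {}"
  shows "merge_sign A (pair_union T) = 1"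
  using assms(2,3)
proof (induction T rule: finite_induct)
  case (insert c T)
  let ?a = "Suc (2 * c)" and ?b = "Suc (Suc (2 * c))"
  \<comment> \<open>The indices of \<open>A\<close> above the pair: each is inverted with both of its members.\<close>
  let ?X = "{a \<in> A. ?b < a}"
  have "inversions A {?a, ?b} = (?X \<times> {?a, ?b})"
    using insert.prems by (auto simp: inversions_def pair_union_insert) (metis Suc_lessI)
  then have "merge_sign A {?a, ?b} = (1::'a)"
    by (simp add: merge_sign_def card_cartesian_product)
  moreover have "merge_sign A (pair_union (insert c T)) =
      merge_sign A {?a, ?b} * (merge_sign A (pair_union T) :: 'a)"
    unfolding pair_union_insert using insert assms(1) by (intro merge_sign_Un_right) auto
  ultimately show ?case
    using insert by (simp add: pair_union_insert)
qed simp

text \<open>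
  The divided power \<open>\<omega>\<^sup>k / k!\<close> of \<open>\<omega> = x\<^sub>1 x\<^sub>2 + x\<^sub>3 x\<^sub>4 + \<dots>\<close>.
\<close>
definition pairing_form :: "nat \<Rightarrow> nat \<Rightarrow> nat set \<Rightarrow> rat" where
  "pairing_form n k S = (if \<exists>T. T \<subseteq> {..<n div 2} \<and> card T = k \<and> S = pair_union T then 1 else 0)"

text \<open>
  The matrix of right multiplication by \<open>f\<close> in the bases of square-free monomials, see
  \<open>wedge_eq_mult_matrix\<close> below; \<open>S\<close> is the row index and \<open>A\<close> the column index.
\<close>
definition mult_matrix :: "(nat set \<Rightarrow> 'k::comm_ring_1) \<Rightarrow> nat set \<Rightarrow> nat set \<Rightarrow> 'k" where
  "mult_matrix f S A = (if A \<subseteq> S then merge_sign A (S - A) * f (S - A) else 0)"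

lemma mult_matrix_pairing_form:
  assumes "finite S"
  shows "mult_matrix (pairing_form n k) S A =
    (if A \<subseteq> S \<and> (\<exists>T. T \<subseteq> {..<n div 2} \<and> card T = k \<and> S - A = pair_union T) then 1 else 0)"
proof (cases "A \<subseteq> S \<and> (\<exists>T. T \<subseteq> {..<n div 2} \<and> card T = k \<and> S - A = pair_union T)")
  case True
  then obtain T where T: "A \<subseteq> S" "T \<subseteq> {..<n div 2}" "card T = k" "S - A = pair_union T" by blast
  have "finite A" "finite T"
    using T assms by (auto intro: finite_subset)
  moreover have "A \<inter> pair_union T = {}"
    unfolding T(4)[symmetric] by blast
  ultimately have "merge_sign A (S - A) = (1::rat)"
    unfolding T(4) by (rule merge_sign_pair_union)
  moreover have "pairing_form n k (S - A) = 1"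
    unfolding pairing_form_def using T by auto
  ultimately show ?thesis
    using T(1) True by (simp add: mult_matrix_def)
next
  case False
  then show ?thesis
    unfolding mult_matrix_def pairing_form_def by auto
qed

lemma finite_squarefree_monomials [simp]: "finite (squarefree_monomials n d)"
  unfolding squarefree_monomials_def by (rule finite_subset[of _ "Pow {1..n}"]) auto

lemma squarefree_monomials_finite: "S \<in> squarefree_monomials n d \<Longrightarrow> finite S"
  by (auto simp: squarefree_monomials_def intro: finite_subset)

text \<open>
  Let \<open>T0\<close> be the set of pairs contained in \<open>A0\<close>, let \<open>H\<close> be the rest of \<open>A0\<close>, and let \<open>F\<close> be the set of pairs
  disjoint from \<open>H\<close>. Among the monomials, those of the form \<open>H \<union> pair_union T\<close> with \<open>T \<subseteq> F\<close> span a block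
  of the matrix, and this block is an inclusion matrix. Each pair outside \<open>F\<close> uses up an element of \<open>H\<close>, whence
  \<open>card F \<ge> n div 2 - card H\<close>, and this is the bound that Gottlieb's theorem asks for.
\<close>
lemma pairing_form_mult_injective:
  fixes x :: "nat set \<Rightarrow> rat"
  assumes le: "2 * j + 2 * k \<le> n"
    and zero: "\<forall>S\<in>squarefree_monomials n (j + 2 * k).
      (\<Sum>A\<in>squarefree_monomials n j. mult_matrix (pairing_form n k) S A * x A) = 0"
  shows "\<forall>A\<in>squarefree_monomials n j. x A = 0"
proof
  fix A0 assume A0: "A0 \<in> squarefree_monomials n j"
  define P where "P = {..<n div 2}"
  define T0 where "T0 = {c \<in> P. Suc (2 * c) \<in> A0 \<and> Suc (Suc (2 * c)) \<in> A0}"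
  define H where "H = A0 - pair_union T0"
  define F where "F = {c \<in> P. Suc (2 * c) \<notin> H \<and> Suc (Suc (2 * c)) \<notin> H}"
  define t where "t = card T0"
  have A0': "A0 \<subseteq> {1..n}" "card A0 = j" "finite A0" "finite H"
    using A0 squarefree_monomials_finite[OF A0] by (auto simp: squarefree_monomials_def H_def)
  have finP: "finite P" "finite F" "finite T0"
    by (auto simp: P_def F_def T0_def)
  have T0F: "T0 \<subseteq> F" by (auto simp: T0_def F_def H_def)
  have T0A: "pair_union T0 \<subseteq> A0"
    unfolding pair_union_conv_image by (auto simp: T0_def)
  \<comment> \<open>A pair inside \<open>H\<close> would lie inside \<open>A0\<close>, so it was removed with \<open>T0\<close>.\<close>
  have half: "\<not> (Suc (2 * c) \<in> H \<and> Suc (Suc (2 * c)) \<in> H)" if "c \<in> P" for c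
    using that by (auto simp: H_def T0_def)
  have HF: "H \<inter> pair_union T = {}" if "T \<subseteq> F" for T
    using that unfolding pair_union_conv_image by (auto simp: F_def)
  have cardA0: "j = card H + 2 * t"
    using A0' T0A finP card_mono[OF A0'(3) T0A]
    by (simp add: H_def t_def card_Diff_subset card_pair_union)
  have "P - F \<subseteq> (\<lambda>x. (x - 1) div 2) ` H"
  proof
    fix c assume "c \<in> P - F"
    then have "Suc (2 * c) \<in> H \<or> Suc (Suc (2 * c)) \<in> H" by (auto simp: F_def)
    then show "c \<in> (\<lambda>x. (x - 1) div 2) ` H"
      by (auto intro: rev_image_eqI)
  qed
  then have "card (P - F) \<le> card H"
    using A0'(4) by (meson card_image_le card_mono finite_imageI le_trans)
  moreover have "card (P - F) = n div 2 - card F"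
    using finP by (subst card_Diff_subset) (auto simp: F_def P_def)
  ultimately have "n div 2 \<le> card F + card H" by linarith
  then have tF: "t + (t + k) \<le> card F"
    using cardA0 le by linarith
  have "x (H \<union> pair_union T0) = 0"
  proof (rule inclusion_matrix_injective[where \<phi> = "\<lambda>T. x (H \<union> pair_union T)", OF finP(2) _ tF _ T0F])
    fix T' assume T': "T' \<subseteq> F" "card T' = t + k"
    define S where "S = H \<union> pair_union T'"
    have fT': "finite T'" using T' finP by (auto intro: finite_subset)
    have FP: "F \<subseteq> {..<n div 2}" by (auto simp: F_def P_def)
    have Sn: "S \<in> squarefree_monomials n (j + 2 * k)"
    proof -
      have "card S = card H + 2 * card T'"
        unfolding S_def using A0' fT' HF[OF T'(1)] by (simp add: card_Un_disjoint card_pair_union)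
      moreover have "S \<subseteq> {1..n}"
        unfolding S_def using A0' T' FP pair_union_subset[of T' n] by (auto simp: H_def)
      ultimately show ?thesis
        using T' cardA0 by (simp add: squarefree_monomials_def)
    qed
    define \<T> where "\<T> = {T. T \<subseteq> T' \<and> card T = t}"
    have inj: "inj_on (\<lambda>T. H \<union> pair_union T) \<T>"
    proof (rule inj_onI)
      fix T R assume TR: "T \<in> \<T>" "R \<in> \<T>" "H \<union> pair_union T = H \<union> pair_union R"
      have "H \<inter> pair_union T = {}" "H \<inter> pair_union R = {}"
        using TR T' by (auto simp: \<T>_def intro!: HF)
      then have "pair_union T = pair_union R" using TR(3) by blast
      then show "T = R" 
        by (metis mem_pair_union_pair(1) subsetI subset_antisym)
    qed
    have entry1: "H \<union> pair_union T \<in> squarefree_monomials n j \<and>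
        mult_matrix (pairing_form n k) S (H \<union> pair_union T) = 1" if T: "T \<in> \<T>" for T
    proof
      have T1: "T \<subseteq> T'" "T \<subseteq> F" "finite T" "card T = t"
        using T T' fT' by (auto simp: \<T>_def intro: finite_subset)
      have "card (H \<union> pair_union T) = j"
        using A0' T1 HF[OF T1(2)] cardA0 by (simp add: card_Un_disjoint card_pair_union)
      moreover have "H \<union> pair_union T \<subseteq> {1..n}"
        using A0' T1 FP pair_union_subset[of T n] by (auto simp: H_def)
      ultimately show "H \<union> pair_union T \<in> squarefree_monomials n j"
        by (simp add: squarefree_monomials_def)
      have "S - (H \<union> pair_union T) = pair_union (T' - T)"
        unfolding S_def pair_union_Diff using HF[OF T'(1)] by blast
      moreover have "card (T' - T) = k" "T' - T \<subseteq> {..<n div 2}"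
        using T1 T' FP by (auto simp: card_Diff_subset)
      moreover have "H \<union> pair_union T \<subseteq> S"
        unfolding S_def using pair_union_mono[OF T1(1)] by blast
      ultimately show "mult_matrix (pairing_form n k) S (H \<union> pair_union T) = 1"
        unfolding mult_matrix_pairing_form[OF squarefree_monomials_finite[OF Sn]] by auto
    qed
    have entry0: "mult_matrix (pairing_form n k) S A = 0"
      if A: "A \<in> squarefree_monomials n j" "A \<notin> (\<lambda>T. H \<union> pair_union T) ` \<T>" for A
    proof (rule ccontr)
      assume "mult_matrix (pairing_form n k) S A \<noteq> 0"
      then obtain R where R: "A \<subseteq> S" "R \<subseteq> {..<n div 2}" "card R = k" "S - A = pair_union R"
        unfolding mult_matrix_pairing_form[OF squarefree_monomials_finite[OF Sn]]
        by (auto split: if_splits)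
      have RT': "R \<subseteq> T'"
      proof
        fix c assume c: "c \<in> R"
        then have "Suc (2 * c) \<in> S" "Suc (Suc (2 * c)) \<in> S"
          using R(4) mem_pair_union_pair by (metis DiffD1)+
        moreover have "c \<in> P" using c R by (auto simp: P_def)
        ultimately show "c \<in> T'" using half[of c] by (auto simp: S_def)
      qed
      have "A = H \<union> pair_union (T' - R)"
        using R(1,4) HF[of R] RT' T'(1) unfolding S_def pair_union_Diff by blast
      moreover have "T' - R \<in> \<T>"
        using RT' R(3) T'(2) fT' by (auto simp: \<T>_def card_Diff_subset finite_subset)
      ultimately show False using A(2) by blast
    qed
    have "0 = (\<Sum>A\<in>squarefree_monomials n j. mult_matrix (pairing_form n k) S A * x A)"
      using zero Sn by simp
    also have "\<dots> = (\<Sum>A\<in>(\<lambda>T. H \<union> pair_union T) ` \<T>. mult_matrix (pairing_form n k) S A * x A)"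
      using entry1 entry0 by (intro sum.mono_neutral_right) auto
    also have "\<dots> = (\<Sum>T\<in>\<T>. x (H \<union> pair_union T))"
      using entry1 by (simp add: sum.reindex[OF inj])
    finally show "(\<Sum>T | T \<subseteq> T' \<and> card T = t. x (H \<union> pair_union T)) = 0"
      by (simp add: \<T>_def)
  qed (simp_all add: t_def)
  moreover have "H \<union> pair_union T0 = A0" using T0A by (auto simp: H_def)
  ultimately show "x A0 = 0" by simp
qed

lemma squarefree_monomials_complement:
  assumes "S \<in> squarefree_monomials n i"
  shows "{1..n} - S \<in> squarefree_monomials n (n - i)" "{1..n} - ({1..n} - S) = S" "i \<le> n"
  using assms squarefree_monomials_finite[OF assms] card_mono[of "{1..n}" S]
  by (auto simp: squarefree_monomials_def card_Diff_subset)

text \<open>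
  Complementation in \<open>{1..n}\<close> reverses inclusions and preserves differences, so it carries the
  transpose of the matrix in degree \<open>j\<close> to the matrix in degree \<open>n - (j + 2 k)\<close>.
\<close>
lemma pairing_form_mult_transpose_injective:
  fixes y :: "nat set \<Rightarrow> rat"
  assumes ge: "n \<le> 2 * j + 2 * k"
    and zero: "\<forall>A\<in>squarefree_monomials n j.
      (\<Sum>S\<in>squarefree_monomials n (j + 2 * k). mult_matrix (pairing_form n k) S A * y S) = 0"
  shows "\<forall>S\<in>squarefree_monomials n (j + 2 * k). y S = 0"
proof
  fix S0 assume S0: "S0 \<in> squarefree_monomials n (j + 2 * k)"
  define l where "l = n - (j + 2 * k)"
  have jn: "j + 2 * k \<le> n" and l: "2 * l + 2 * k \<le> n" "n - j = l + 2 * k"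
    "n - l = j + 2 * k" "n - (l + 2 * k) = j"
    using squarefree_monomials_complement(3)[OF S0] ge by (auto simp: l_def)
  have "\<forall>B\<in>squarefree_monomials n l. y ({1..n} - B) = 0"
  proof (rule pairing_form_mult_injective[OF l(1)], intro ballI)
    fix S' assume S': "S' \<in> squarefree_monomials n (l + 2 * k)"
    have A: "{1..n} - S' \<in> squarefree_monomials n j"
      using squarefree_monomials_complement(1)[OF S'] l by simp
    have "(\<Sum>B\<in>squarefree_monomials n l. mult_matrix (pairing_form n k) S' B * y ({1..n} - B)) =
        (\<Sum>S\<in>squarefree_monomials n (j + 2 * k). mult_matrix (pairing_form n k) S ({1..n} - S') * y S)"
    proof (rule sum.reindex_bij_witness[where i = "\<lambda>B. {1..n} - B" and j = "\<lambda>B. {1..n} - B"], goal_cases)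
      case (5 B)
      have fin: "finite S'" "finite ({1..n} - B)" and Bn: "B \<subseteq> {1..n}" "S' \<subseteq> {1..n}"
        using 5 S' by (auto simp: squarefree_monomials_def intro: finite_subset)
      have "B \<subseteq> S' \<longleftrightarrow> {1..n} - S' \<subseteq> {1..n} - B" "({1..n} - B) - ({1..n} - S') = S' - B"
        using Bn by auto
      then show ?case
        unfolding mult_matrix_pairing_form[OF fin(1)] mult_matrix_pairing_form[OF fin(2)] by simp
    qed (use squarefree_monomials_complement l(3) l_def jn in \<open>force+\<close>)
    also have "\<dots> = 0" using zero A by blast
    finally show "(\<Sum>B\<in>squarefree_monomials n l. mult_matrix (pairing_form n k) S' B * y ({1..n} - B)) = 0" .
  qed
  moreover have "{1..n} - S0 \<in> squarefree_monomials n l"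
    using squarefree_monomials_complement(1)[OF S0] by (simp add: l_def)
  ultimately show "y S0 = 0"
    using squarefree_monomials_complement(2)[OF S0] by force
qed

section \<open>The ideal generated by an even form\<close>

text \<open>
  For disjoint \<open>A\<close> and \<open>B\<close>, every pair in \<open>A \<times> B\<close> is inverted in exactly one of the two orders. So the
  two inversion numbers add up to \<open>card A * card B\<close>, and they have the same parity if that product is even.
\<close>
lemma merge_sign_swap:
  assumes "finite A" "finite B" "A \<inter> B = {}" "even (card A) \<or> even (card B)"
  shows "merge_sign A B = (merge_sign B A :: 'k::comm_ring_1)"
proof -
  have "card (inversions A B) + card (inversions B A) = card A * card B"
  proof -
    have "card (inversions B A) = card ((\<lambda>(a, b). (b, a)) ` inversions B A)"
      by (intro card_image[symmetric]) (auto simp: inj_on_def)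
    moreover have "inversions A B \<inter> (\<lambda>(a, b). (b, a)) ` inversions B A = {}"
      by (auto simp: inversions_def)
    moreover have "inversions A B \<union> (\<lambda>(a, b). (b, a)) ` inversions B A = A \<times> B"
      using assms(3) by (fastforce simp: inversions_def image_iff)
    ultimately show ?thesis
      using assms(1,2) finite_inversions[of A B] finite_inversions[of B A]
      by (metis card_Un_disjoint card_cartesian_product finite_imageI)
  qed
  then have "even (card (inversions A B) + card (inversions B A))"
    using assms(4) by auto
  then show ?thesis
    by (auto simp: merge_sign_def minus_one_power_iff)
qed

lemma even_form_central:
  fixes f :: "nat set \<Rightarrow> 'k::field"
  assumes "f \<in> ext_degree n d" "even d"
  shows "wedge f u = wedge u f"
proof
  fix S
  show "wedge f u S = wedge u f S"
  proof (cases "finite S")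
    case True
    have "wedge f u S = (\<Sum>A\<in>Pow S. merge_sign (S - A) A * f (S - A) * u A)"
      unfolding wedge_def
      by (rule sum.reindex_bij_witness[of _ "\<lambda>A. S - A" "\<lambda>A. S - A"]) (auto simp: double_diff)
    also have "\<dots> = wedge u f S"
      unfolding wedge_def
    proof (intro sum.cong refl)
      fix A assume A: "A \<in> Pow S"
      show "merge_sign (S - A) A * f (S - A) * u A = merge_sign A (S - A) * u A * f (S - A)"
      proof (cases "f (S - A) = 0")
        case False
        then have "even (card (S - A))"
          using assms by (auto simp: ext_degree_def squarefree_monomials_def)
        moreover have "finite A" "finite (S - A)"
          using A True by (auto intro: finite_subset)
        ultimately have "merge_sign (S - A) A = (merge_sign A (S - A) :: 'k)"
          by (intro merge_sign_swap) auto
        then show ?thesis by (simp add: mult_ac)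
      qed simp
    qed
    finally show ?thesis .
  qed (simp add: wedge_infinite)
qed

lemma genideal_central:
  assumes "ring R" and f: "f \<in> carrier R"
    and central: "\<And>u. u \<in> carrier R \<Longrightarrow> f \<otimes>\<^bsub>R\<^esub> u = u \<otimes>\<^bsub>R\<^esub> f"
  shows "Idl\<^bsub>R\<^esub> {f} = (\<lambda>u. u \<otimes>\<^bsub>R\<^esub> f) ` carrier R"
proof -
  interpret R: ring R by fact
  have "ideal ((\<lambda>u. u \<otimes>\<^bsub>R\<^esub> f) ` carrier R) R"
  proof (rule idealI)
    show "subgroup ((\<lambda>u. u \<otimes>\<^bsub>R\<^esub> f) ` carrier R) (add_monoid R)"
    proof (rule R.add.subgroupI)
      fix a assume "a \<in> (\<lambda>u. u \<otimes>\<^bsub>R\<^esub> f) ` carrier R"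
      then obtain u where u: "u \<in> carrier R" "a = u \<otimes>\<^bsub>R\<^esub> f" by blast
      then have "\<ominus>\<^bsub>R\<^esub> a = (\<ominus>\<^bsub>R\<^esub> u) \<otimes>\<^bsub>R\<^esub> f" using f by (simp add: R.l_minus)
      then show "\<ominus>\<^bsub>R\<^esub> a \<in> (\<lambda>u. u \<otimes>\<^bsub>R\<^esub> f) ` carrier R"
        using u by simp
      fix b assume "b \<in> (\<lambda>u. u \<otimes>\<^bsub>R\<^esub> f) ` carrier R"
      then obtain v where v: "v \<in> carrier R" "b = v \<otimes>\<^bsub>R\<^esub> f" by blast
      have "a \<oplus>\<^bsub>R\<^esub> b = (u \<oplus>\<^bsub>R\<^esub> v) \<otimes>\<^bsub>R\<^esub> f" using u v f by (simp add: R.l_distr)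
      then show "a \<oplus>\<^bsub>R\<^esub> b \<in> (\<lambda>u. u \<otimes>\<^bsub>R\<^esub> f) ` carrier R"
        using u v by simp
    qed (use f in auto)
  next
    fix a x assume "a \<in> (\<lambda>u. u \<otimes>\<^bsub>R\<^esub> f) ` carrier R" and x: "x \<in> carrier R"
    then obtain u where u: "u \<in> carrier R" "a = u \<otimes>\<^bsub>R\<^esub> f" by blast
    have "x \<otimes>\<^bsub>R\<^esub> a = (x \<otimes>\<^bsub>R\<^esub> u) \<otimes>\<^bsub>R\<^esub> f" using u x f by (simp add: R.m_assoc)
    then show "x \<otimes>\<^bsub>R\<^esub> a \<in> (\<lambda>u. u \<otimes>\<^bsub>R\<^esub> f) ` carrier R" using u x by simp
    have "a \<otimes>\<^bsub>R\<^esub> x = (u \<otimes>\<^bsub>R\<^esub> x) \<otimes>\<^bsub>R\<^esub> f" using u x f central[OF x] by (simp add: R.m_assoc)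
    then show "a \<otimes>\<^bsub>R\<^esub> x \<in> (\<lambda>u. u \<otimes>\<^bsub>R\<^esub> f) ` carrier R" using u x by simp
  qed (fact \<open>ring R\<close>)
  moreover have "f \<in> (\<lambda>u. u \<otimes>\<^bsub>R\<^esub> f) ` carrier R"
    using f by (intro image_eqI[of _ _ "\<one>\<^bsub>R\<^esub>"]) simp_all
  ultimately have "Idl\<^bsub>R\<^esub> {f} \<subseteq> (\<lambda>u. u \<otimes>\<^bsub>R\<^esub> f) ` carrier R"
    by (intro R.genideal_minimal) auto
  moreover have "(\<lambda>u. u \<otimes>\<^bsub>R\<^esub> f) ` carrier R \<subseteq> Idl\<^bsub>R\<^esub> {f}"
  proof -
    interpret I: ideal "Idl\<^bsub>R\<^esub> {f}" R
      using f by (intro R.genideal_ideal) auto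
    have "f \<in> Idl\<^bsub>R\<^esub> {f}" using f by (rule R.genideal_self')
    then show ?thesis by (auto intro: I.I_l_closed)
  qed
  ultimately show ?thesis by blast
qed

lemma ext_degreeD: "u \<in> ext_degree n j \<Longrightarrow> u A \<noteq> 0 \<Longrightarrow> A \<in> squarefree_monomials n j"
  by (auto simp: ext_degree_def)

lemma wedge_eq_mult_matrix:
  assumes "u \<in> ext_degree n j" "finite S"
  shows "wedge u f S = (\<Sum>A\<in>squarefree_monomials n j. mult_matrix f S A * u A)"
proof -
  have "wedge u f S = (\<Sum>A\<in>Pow S. mult_matrix f S A * u A)"
    unfolding wedge_def mult_matrix_def by (intro sum.cong) (auto simp: mult_ac)
  also have "\<dots> = (\<Sum>A\<in>Pow S \<union> squarefree_monomials n j. mult_matrix f S A * u A)"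
    using assms(2) by (intro sum.mono_neutral_left) (auto simp: mult_matrix_def)
  also have "\<dots> = (\<Sum>A\<in>squarefree_monomials n j. mult_matrix f S A * u A)"
    using assms by (intro sum.mono_neutral_right) (auto dest: ext_degreeD)
  finally show ?thesis .
qed

lemma wedge_nonzeroE:
  assumes "wedge u f S \<noteq> (0::'k::comm_ring_1)"
  obtains A where "A \<subseteq> S" "finite S" "u A \<noteq> 0" "f (S - A) \<noteq> 0"
proof -
  from assms obtain A where "A \<in> Pow S" "merge_sign A (S - A) * u A * f (S - A) \<noteq> 0"
    unfolding wedge_def by (meson sum.not_neutral_contains_not_neutral)
  moreover have "finite S" using assms wedge_infinite by blast
  ultimately show ?thesis using that by (metis PowD mult_zero_left mult_zero_right)
qed

lemma wedge_ext_degree: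
  assumes "u \<in> ext_degree n j" "f \<in> ext_degree n d"
  shows "wedge u f \<in> ext_degree n (j + d)"
  unfolding ext_degree_def
proof safe
  fix S assume "wedge u f S \<noteq> 0"
  then obtain A where A: "A \<subseteq> S" "finite S" "u A \<noteq> 0" "f (S - A) \<noteq> 0"
    by (rule wedge_nonzeroE)
  then have AS: "A \<in> squarefree_monomials n j" "S - A \<in> squarefree_monomials n d"
    using assms by (auto dest: ext_degreeD)
  have "card S = card A + card (S - A)"
    using A by (simp add: card_Diff_subset finite_subset card_mono)
  then show "S \<in> squarefree_monomials n (j + d)"
    using AS by (auto simp: squarefree_monomials_def)
qed

text \<open>
  A homogeneous element \<open>u f\<close> of degree \<open>i\<close> depends only on the component of \<open>u\<close> of degree \<open>i - d\<close>,
  so \<open>u\<close> can be replaced by this component.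
\<close>
lemma ext_ideal_degree:
  fixes f :: "nat set \<Rightarrow> 'k::field"
  assumes f: "f \<in> ext_degree n d" "even d"
  shows "ext_ideal n f \<inter> ext_degree n i =
    (if d \<le> i then (\<lambda>u. wedge u f) ` ext_degree n (i - d) else {\<lambda>_. 0})"
proof -
  let ?E = "exterior_algebra n :: ('k, nat set \<Rightarrow> 'k) module"
  have simps: "u \<otimes>\<^bsub>?E\<^esub> v = wedge u v" for u v by (simp add: exterior_algebra_def)
  have ideal: "ext_ideal n f = (\<lambda>u. wedge u f) ` carrier ?E"
    unfolding ext_ideal_def simps[symmetric] using f ext_degree_subset
    by (intro genideal_central exterior_algebra_ring) (auto simp: simps even_form_central[OF f])
  show ?thesis
  proof (intro equalityI subsetI)
    fix w assume "w \<in> ext_ideal n f \<inter> ext_degree n i"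
    then obtain u where u: "u \<in> carrier ?E" "w = wedge u f" and w: "w \<in> ext_degree n i"
      unfolding ideal by blast
    have deg: "d + card A = i" if "A \<subseteq> S" "finite S" "u A \<noteq> 0" "f (S - A) \<noteq> 0" "w S \<noteq> 0" for A S
    proof -
      have "card S = i" "card (S - A) = d"
        using that w f(1) by (auto dest!: ext_degreeD simp: squarefree_monomials_def)
      then show ?thesis
        using that by (metis add.commute card_Diff_subset card_mono finite_subset le_add_diff_inverse)
    qed
    show "w \<in> (if d \<le> i then (\<lambda>u. wedge u f) ` ext_degree n (i - d) else {\<lambda>_. 0})"
    proof (cases "d \<le> i")
      case True
      define v where "v A = (if card A = i - d then u A else 0)" for A
      have v: "v \<in> ext_degree n (i - d)"
        using u(1) by (auto simp: v_def ext_degree_def squarefree_monomials_def exterior_algebra_def)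
      have "w S = wedge v f S" for S
      proof (cases "card S = i \<and> finite S")
        case S: True
        have "wedge u f S = wedge v f S"
          unfolding wedge_def
        proof (intro sum.cong refl)
          fix A assume A: "A \<in> Pow S"
          show "merge_sign A (S - A) * u A * f (S - A) = merge_sign A (S - A) * v A * f (S - A)"
          proof (cases "f (S - A) = 0")
            case False
            then have "card (S - A) = d"
              using f(1) by (auto dest!: ext_degreeD simp: squarefree_monomials_def)
            then have "card A = i - d"
              using A S by (metis PowD card_Diff_subset card_mono diff_diff_cancel finite_subset)
            then show ?thesis by (simp add: v_def)
          qed simp
        qed
        then show ?thesis by (simp add: u(2))
      next
        case False
        then have "S \<notin> squarefree_monomials n i"
          by (auto simp: squarefree_monomials_def intro: finite_subset)
        moreover have "wedge v f \<in> ext_degree n i"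
          using wedge_ext_degree[OF v f(1)] True by simp
        ultimately show ?thesis
          using w ext_degreeD by metis
      qed
      then show ?thesis using True v by auto
    next
      case False
      have "w S = 0" for S
      proof (rule ccontr)
        assume "w S \<noteq> 0"
        then obtain A where "A \<subseteq> S" "finite S" "u A \<noteq> 0" "f (S - A) \<noteq> 0"
          unfolding u(2) by (rule wedge_nonzeroE)
        with deg \<open>w S \<noteq> 0\<close> False show False by force
      qed
      then show ?thesis using False by auto
    qed
  next
    fix w assume w: "w \<in> (if d \<le> i then (\<lambda>u. wedge u f) ` ext_degree n (i - d) else {\<lambda>_. 0})"
    show "w \<in> ext_ideal n f \<inter> ext_degree n i"
    proof (cases "d \<le> i")
      case True
      then obtain u where u: "u \<in> ext_degree n (i - d)" "w = wedge u f" using w by auto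
      then show ?thesis
        using wedge_ext_degree[OF u(1) f(1)] ext_degree_subset True unfolding ideal by auto
    next
      case False
      then have "w = (\<lambda>_. 0)" using w by simp
      moreover have "(\<lambda>_. 0) = wedge (\<lambda>_. 0) f" by (simp add: wedge_def)
      ultimately show ?thesis
        unfolding ideal by (auto simp: ext_degree_def exterior_algebra_def)
    qed
  qed
qed

section \<open>Multiplication by a generic form\<close>

text \<open>
  Since the coefficients of \<open>f\<close> are pairwise distinct, the value of a coefficient of \<open>f\<close> determines its monomial; this makes
  the substitution of the coefficients of \<open>g\<close> for those of \<open>f\<close> well defined.
\<close>
lemma generic_form_specializes:
  fixes f :: "nat set \<Rightarrow> 'k::field_char_0"
  assumes f: "generic_form n d f"
    and SA: "S \<in> squarefree_monomials n (j + d)" "A \<in> squarefree_monomials n j"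
  shows "specializes (f ` squarefree_monomials n d) (\<lambda>a. g (inv_into (squarefree_monomials n d) f a))
    (mult_matrix f S A) (mult_matrix g S A)"
proof (cases "A \<subseteq> S")
  case True
  let ?I = "squarefree_monomials n d" and ?h = "\<lambda>a. g (inv_into (squarefree_monomials n d) f a)"
  have "S - A \<in> ?I"
    using SA True squarefree_monomials_finite[OF SA(2)]
    by (auto simp: squarefree_monomials_def card_Diff_subset)
  moreover have "inj_on f ?I"
    using f by (auto simp: generic_form_def inj_on_def)
  ultimately have "specializes (f ` ?I) ?h (f (S - A)) (g (S - A))"
    using specializes_var[of "f (S - A)" "f ` ?I" ?h] by simp
  moreover have "specializes (f ` ?I) ?h (merge_sign A (S - A)) (merge_sign A (S - A))"
    using specializes_of_rat[of "f ` ?I" ?h "merge_sign A (S - A)"]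
    by (simp add: merge_sign_def of_rat_power of_rat_minus)
  ultimately show ?thesis
    using True by (simp add: mult_matrix_def specializes_mult)
next
  case False
  then show ?thesis
    using specializes_of_rat[of _ _ 0] by (simp add: mult_matrix_def)
qed

lemma generic_mult_injective:
  fixes f :: "nat set \<Rightarrow> 'k::field_char_0"
  assumes f: "generic_form n d f" "even d" and le: "2 * j + d \<le> n"
  shows "inj_on (\<lambda>u. wedge u f) (ext_degree n j)"
proof (rule inj_onI)
  fix u v assume uv: "u \<in> ext_degree n j" "v \<in> ext_degree n j" "wedge u f = wedge v f"
  have A: "alg_independent_rat (f ` squarefree_monomials n d)"
    using f(1) by (simp add: generic_form_def)
  obtain k where k: "d = 2 * k" using f(2) by blast
  have "\<forall>A\<in>squarefree_monomials n j. u A - v A = 0"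
  proof (rule specialization_injective[OF finite_squarefree_monomials finite_squarefree_monomials A
        generic_form_specializes[OF f(1), where g = "pairing_form n k"]])
    show "\<forall>A\<in>squarefree_monomials n j. x A = 0"
      if "\<forall>S\<in>squarefree_monomials n (j + d).
        (\<Sum>A\<in>squarefree_monomials n j. mult_matrix (pairing_form n k) S A * x A) = 0" for x
      using that pairing_form_mult_injective[of j k n x] le k by auto
    show "\<forall>S\<in>squarefree_monomials n (j + d).
        (\<Sum>A\<in>squarefree_monomials n j. mult_matrix f S A * (u A - v A)) = 0"
    proof
      fix S assume "S \<in> squarefree_monomials n (j + d)"
      then have "finite S" by (rule squarefree_monomials_finite)
      then have "(\<Sum>A\<in>squarefree_monomials n j. mult_matrix f S A * (u A - v A)) =
          wedge u f S - wedge v f S"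
        using uv(1,2) by (simp add: wedge_eq_mult_matrix right_diff_distrib sum_subtractf)
      then show "(\<Sum>A\<in>squarefree_monomials n j. mult_matrix f S A * (u A - v A)) = 0"
        using uv(3) by simp
    qed
  qed
  moreover have "u A = 0" "v A = 0" if "A \<notin> squarefree_monomials n j" for A
    using that uv by (auto dest: ext_degreeD)
  ultimately show "u = v"
    by (metis eq_iff_diff_eq_0 ext)
qed

lemma generic_mult_surjective:
  fixes f :: "nat set \<Rightarrow> 'k::field_char_0"
  assumes f: "generic_form n d f" "even d" and ge: "n \<le> 2 * j + d"
  shows "(\<lambda>u. wedge u f) ` ext_degree n j = ext_degree n (j + d)"
proof (intro equalityI subsetI)
  have fd: "f \<in> ext_degree n d" and A: "alg_independent_rat (f ` squarefree_monomials n d)"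
    using f(1) by (auto simp: generic_form_def)
  obtain k where k: "d = 2 * k" using f(2) by blast
  show "w \<in> ext_degree n (j + d)" if "w \<in> (\<lambda>u. wedge u f) ` ext_degree n j" for w
    using that wedge_ext_degree[OF _ fd] by auto
  fix w :: "nat set \<Rightarrow> 'k" assume w: "w \<in> ext_degree n (j + d)"
  have "\<exists>x. \<forall>S\<in>squarefree_monomials n (j + d).
      (\<Sum>A\<in>squarefree_monomials n j. mult_matrix f S A * x A) = w S"
  proof (rule specialization_surjective[OF finite_squarefree_monomials finite_squarefree_monomials A
        generic_form_specializes[OF f(1), where g = "pairing_form n k"]])
    show "\<forall>S\<in>squarefree_monomials n (j + d). y S = 0"
      if "\<forall>A\<in>squarefree_monomials n j.
        (\<Sum>S\<in>squarefree_monomials n (j + d). mult_matrix (pairing_form n k) S A * y S) = 0" for y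
      using that pairing_form_mult_transpose_injective[of n j k y] ge k by auto
  qed
  then obtain x where x: "\<forall>S\<in>squarefree_monomials n (j + d).
      (\<Sum>A\<in>squarefree_monomials n j. mult_matrix f S A * x A) = w S" by blast
  define u where "u A = (if A \<in> squarefree_monomials n j then x A else 0)" for A
  have u: "u \<in> ext_degree n j" by (auto simp: u_def ext_degree_def)
  have "wedge u f S = w S" for S
  proof (cases "S \<in> squarefree_monomials n (j + d)")
    case True
    have "wedge u f S = (\<Sum>A\<in>squarefree_monomials n j. mult_matrix f S A * x A)"
      unfolding wedge_eq_mult_matrix[OF u squarefree_monomials_finite[OF True]]
      by (intro sum.cong) (auto simp: u_def)
    then show ?thesis using x True by simp
  next
    case False
    then show ?thesis using w wedge_ext_degree[OF u fd] ext_degreeD by metis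
  qed
  then show "w \<in> (\<lambda>u. wedge u f) ` ext_degree n j"
    using u by (intro image_eqI[of _ _ u]) auto
qed

section \<open>Dimensions of the graded components\<close>

definition ext_component :: "nat \<Rightarrow> nat \<Rightarrow> ('k::field, nat set \<Rightarrow> 'k) module" where
  "ext_component n j = (exterior_algebra n)\<lparr>carrier := ext_degree n j\<rparr>"

lemma ext_component_simps [simp]:
  "carrier (ext_component n j) = ext_degree n j"
  "\<zero>\<^bsub>ext_component n j\<^esub> = (\<lambda>_. 0)"
  "u \<oplus>\<^bsub>ext_component n j\<^esub> v = (\<lambda>S. u S + v S)"
  "c \<odot>\<^bsub>ext_component n j\<^esub> u = (\<lambda>S. c * u S)"
  by (simp_all add: ext_component_def exterior_algebra_def)

lemma ext_degree_add:
  assumes "u \<in> ext_degree n j" "v \<in> ext_degree n j"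
  shows "(\<lambda>S. u S + v S) \<in> ext_degree n j"
  unfolding ext_degree_def
proof safe
  fix S assume "u S + v S \<noteq> 0"
  then have "u S \<noteq> 0 \<or> v S \<noteq> 0" by auto
  then show "S \<in> squarefree_monomials n j" using assms by (auto dest: ext_degreeD)
qed

lemma ext_degree_smult: "u \<in> ext_degree n j \<Longrightarrow> (\<lambda>S. c * u S) \<in> ext_degree n j"
  by (simp add: ext_degree_def)

lemma ext_component_vectorspace:
  "vectorspace class_ring (ext_component n j :: ('k::field, nat set \<Rightarrow> 'k) module)"
proof (intro vectorspace.intro class_field moduleI abelian_groupI)
  show "cring (class_ring :: 'k ring)" by (rule class_cring.is_cring)
  fix u :: "nat set \<Rightarrow> 'k" assume "u \<in> carrier (ext_component n j)"
  then show "\<exists>v\<in>carrier (ext_component n j). v \<oplus>\<^bsub>ext_component n j\<^esub> u = \<zero>\<^bsub>ext_component n j\<^esub>"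
    by (intro bexI[of _ "\<lambda>S. - u S"]) (auto simp: ext_degree_def)
qed (auto simp: ext_degree_add ext_degree_smult algebra_simps, simp add: ext_degree_def)

lemma ext_component_fin_dim_dim:
  "vectorspace.fin_dim class_ring (ext_component n j :: ('k::field, nat set \<Rightarrow> 'k) module)"
  "vectorspace.dim class_ring (ext_component n j :: ('k::field, nat set \<Rightarrow> 'k) module) = n choose j"
proof -
  let ?I = "squarefree_monomials n j"
  let ?B = "ext_monomial ` ?I :: (nat set \<Rightarrow> 'k) set"
  interpret V: vectorspace class_ring "ext_component n j :: ('k, nat set \<Rightarrow> 'k) module"
    by (rule ext_component_vectorspace)
  have inj: "inj_on (ext_monomial :: nat set \<Rightarrow> nat set \<Rightarrow> 'k) X" for X
    by (rule inj_onI) (metis ext_monomial_def zero_neq_one)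
  have B: "?B \<subseteq> carrier (ext_component n j)" "finite ?B"
    by (auto simp: ext_degree_def ext_monomial_def split: if_splits)
  have lincomb: "V.lincomb a (ext_monomial ` X) = (\<lambda>S. if S \<in> X then a (ext_monomial S) else 0)"
    if "finite X" "X \<subseteq> ?I" for a X
    using that
  proof (induction X rule: finite_induct)
    case empty
    show ?case by (simp add: V.lincomb_empty)
  next
    case (insert T X)
    have "V.lincomb a (ext_monomial ` insert T X) =
        a (ext_monomial T) \<odot>\<^bsub>ext_component n j\<^esub> ext_monomial T \<oplus>\<^bsub>ext_component n j\<^esub> V.lincomb a (ext_monomial ` X)"
      unfolding image_insert
    proof (rule V.lincomb_insert2)
      show "ext_monomial T \<notin> (ext_monomial ` X :: (nat set \<Rightarrow> 'k) set)"
        using insert.hyps inj[of "insert T X"] by (auto simp: inj_on_def)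
    qed (use insert B in auto)
    then show ?case
      using insert by (auto simp: fun_eq_iff ext_monomial_def)
  qed
  have "V.basis ?B"
    unfolding V.basis_def
  proof (intro conjI)
    show "\<not> V.lin_dep ?B"
    proof (rule V.finite_lin_indpt2)
      fix a assume "V.lincomb a ?B = \<zero>\<^bsub>ext_component n j\<^esub>"
      then have "\<forall>S. (if S \<in> ?I then a (ext_monomial S) else 0) = 0"
        by (simp add: lincomb fun_eq_iff)
      then show "\<forall>v\<in>?B. a v = \<zero>\<^bsub>class_ring\<^esub>"
        by (auto split: if_splits)
    qed (use B in auto)
    show "V.span ?B = carrier (ext_component n j)"
    proof
      show "V.span ?B \<subseteq> carrier (ext_component n j)"
        using B(1) by (rule V.span_is_subset2)
      show "carrier (ext_component n j) \<subseteq> V.span ?B"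
      proof
        fix u :: "nat set \<Rightarrow> 'k" assume u: "u \<in> carrier (ext_component n j)"
        define a :: "(nat set \<Rightarrow> 'k) \<Rightarrow> 'k" where "a v = u (inv_into ?I ext_monomial v)" for v
        have "V.lincomb a ?B = u"
        proof
          fix S
          show "V.lincomb a ?B S = u S"
            using u inj[of ?I] by (auto simp: lincomb a_def dest: ext_degreeD)
        qed
        moreover have "V.lincomb a ?B \<in> V.span ?B"
          unfolding V.span_def using B by (auto intro!: exI[of _ a] exI[of _ ?B])
        ultimately show "u \<in> V.span ?B" by simp
      qed
    qed
  qed (rule B(1))
  then have "V.dim = card ?B" "V.fin_dim"
    using B(2) V.dim_basis unfolding V.basis_def V.fin_dim_def by blast+
  moreover have "card ?B = n choose j"
    using n_subsets[of "{1..n}" j] by (simp add: card_image[OF inj] squarefree_monomials_def)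
  ultimately show "V.fin_dim" "V.dim = n choose j" by simp_all
qed

text \<open>
  The zero space appears here as the kernel of the identity, which gives its dimension through
  the rank-nullity theorem.
\<close>
lemma dim_ext_component_zero:
  "vectorspace.dim class_ring ((ext_component n j)\<lparr>carrier := {\<lambda>_. 0 :: 'k::field}\<rparr>) = 0"
proof -
  let ?V = "ext_component n j :: ('k, nat set \<Rightarrow> 'k) module"
  have V: "vectorspace class_ring ?V" by (rule ext_component_vectorspace)
  interpret T: linear_map class_ring ?V ?V "\<lambda>u. u"
    by (intro linear_map.intro V mod_hom.intro mod_hom_axioms.intro)
      (use V in \<open>auto simp: vectorspace_def LinearCombinations.module_hom_def\<close>)
  have "T.ker = {\<lambda>_. 0}"
    unfolding T.ker_def by (auto simp: ext_degree_def)
  then show ?thesis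
    using T.inj_imp_dim_ker0 by simp
qed

text \<open>
  Rank-nullity for the projection of \<open>\<Lambda>\<^sup>i\<close> onto the degree \<open>i\<close> part of the quotient.
\<close>
lemma dim_ext_quotient_degree:
  fixes f :: "nat set \<Rightarrow> 'k::field"
  assumes f: "f \<in> ext_degree n d" "even d"
  shows "vectorspace.dim class_ring (ext_quotient_degree n f i) +
    vectorspace.dim class_ring ((ext_component n i)\<lparr>carrier := ext_ideal n f \<inter> ext_degree n i\<rparr>) = n choose i"
proof -
  let ?E = "exterior_algebra n :: ('k, nat set \<Rightarrow> 'k) module"
  let ?V = "ext_component n i :: ('k, nat set \<Rightarrow> 'k) module"
  let ?Q = "ext_quotient_degree n f i"
  let ?T = "\<lambda>u. ext_ideal n f +>\<^bsub>?E\<^esub> u"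
  have fc: "f \<in> carrier ?E" using f(1) ext_degree_subset by blast
  have sub: "u \<in> carrier ?E" if "u \<in> ext_degree n i" for u
    using that ext_degree_subset by blast
  interpret I: ideal "ext_ideal n f" ?E using fc by (rule ext_ideal_ideal)
  have V: "vectorspace class_ring ?V" and Q: "vectorspace class_ring ?Q"
    by (rule ext_component_vectorspace) (rule ext_quotient_degree_vectorspace[OF fc])
  have add: "u \<oplus>\<^bsub>?E\<^esub> v = u \<oplus>\<^bsub>?V\<^esub> v" and smult: "c \<odot>\<^bsub>?E\<^esub> v = c \<odot>\<^bsub>?V\<^esub> v" for u v c
    by (simp_all add: exterior_algebra_def)
  interpret T: linear_map class_ring ?V ?Q ?T
  proof (intro linear_map.intro V Q mod_hom.intro mod_hom_axioms.intro)
    show "?T \<in> LinearCombinations.module_hom class_ring ?V ?Q"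
      unfolding LinearCombinations.module_hom_def
      using ext_quotient_add_coset[OF fc sub sub] ext_quotient_smult_coset[OF fc sub]
      by (auto simp: ext_quotient_degree_def add smult)
  qed (use V Q in \<open>auto simp: vectorspace_def\<close>)
  have im: "T.im = carrier ?Q"
    unfolding T.im_def by (simp add: ext_quotient_degree_def)
  have "\<zero>\<^bsub>?Q\<^esub> = ext_ideal n f"
    by (simp add: ext_quotient_degree_def ext_quotient_simps FactRing_def)
  moreover have "?T u = ext_ideal n f \<longleftrightarrow> u \<in> ext_ideal n f" if "u \<in> ext_degree n i" for u
    using sub[OF that] I.a_rcos_self I.a_coset_join2 I.a_subgroup by metis
  ultimately have ker: "T.ker = ext_ideal n f \<inter> ext_degree n i"
    unfolding T.ker_def by auto
  show ?thesis
    using T.rank_nullity[OF ext_component_fin_dim_dim(1)]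
    unfolding im ker ext_component_fin_dim_dim(2) by simp
qed

lemma dim_mult_image:
  fixes f :: "nat set \<Rightarrow> 'k::field"
  assumes f: "f \<in> ext_degree n d" and inj: "inj_on (\<lambda>u. wedge u f) (ext_degree n j)"
  shows "vectorspace.dim class_ring ((ext_component n (j + d))\<lparr>carrier := (\<lambda>u. wedge u f) ` ext_degree n j\<rparr>) = n choose j"
proof -
  let ?V = "ext_component n j :: ('k, nat set \<Rightarrow> 'k) module"
  let ?W = "ext_component n (j + d) :: ('k, nat set \<Rightarrow> 'k) module"
  let ?T = "\<lambda>u. wedge u f"
  have V: "vectorspace class_ring ?V" and W: "vectorspace class_ring ?W"
    by (rule ext_component_vectorspace)+
  have add: "wedge (\<lambda>S. u S + v S) f = (\<lambda>S. wedge u f S + wedge v f S)" for u v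
    by (simp add: wedge_def fun_eq_iff algebra_simps sum.distrib)
  have smult: "wedge (\<lambda>S. c * u S) f = (\<lambda>S. c * wedge u f S)" for c u
    by (simp add: wedge_def fun_eq_iff sum_distrib_left mult_ac)
  interpret T: linear_map class_ring ?V ?W ?T
  proof (intro linear_map.intro V W mod_hom.intro mod_hom_axioms.intro)
    show "?T \<in> LinearCombinations.module_hom class_ring ?V ?W"
      unfolding LinearCombinations.module_hom_def
      using wedge_ext_degree[OF _ f] by (auto simp: add smult)
  qed (use V W in \<open>auto simp: vectorspace_def\<close>)
  have im: "T.im = ?T ` ext_degree n j"
    unfolding T.im_def by simp
  have "vectorspace.dim class_ring (?V\<lparr>carrier := T.ker\<rparr>) = 0"
    using inj by (intro T.inj_imp_dim_ker0) simp
  then show ?thesis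
    using T.rank_nullity[OF ext_component_fin_dim_dim(1)]
    unfolding im ext_component_fin_dim_dim(2) by simp
qed

section \<open>The truncated series\<close>

lemma binomial_less_of_sum_less:
  assumes "a < b" "a + b < n"
  shows "n choose a < n choose b"
proof (cases "2 * b \<le> n")
  case True
  then show ?thesis using assms by (intro binomial_strict_mono)
next
  case False
  have "n choose a < n choose (n - b)"
    using assms False by (intro binomial_strict_mono) auto
  then show ?thesis using assms binomial_symmetric[of b n] by simp
qed

lemma binomial_ge_of_sum_ge:
  assumes "a \<le> b" "n \<le> a + b"
  shows "n choose b \<le> n choose a"
proof (cases "b \<le> n")
  case True
  have b: "n choose b = n choose (n - b)"
    using True by (rule binomial_symmetric)
  show ?thesis
  proof (cases "2 * a \<le> n")
    case True
    then show ?thesis unfolding b using assms by (intro binomial_mono) auto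
  next
    case False
    have "n choose (n - b) \<le> n choose (n - a)"
      using assms False by (intro binomial_mono) auto
    then show ?thesis using b binomial_symmetric[of a n] assms True by simp
  qed
qed (simp add: binomial_eq_0)

lemma fps_truncate_pos_nth:
  "fps_nth (fps_truncate_pos g) i = (if \<forall>j\<le>i. fps_nth g j > 0 then fps_nth g i else 0)"
proof (cases "\<forall>j. fps_nth g j > 0")
  case False
  define L where "L = {i. \<forall>j\<le>i. fps_nth g j > 0}"
  have mem: "i \<in> L \<longleftrightarrow> (\<forall>j\<le>i. fps_nth g j > 0)" for i
    by (simp add: L_def)
  obtain m where m: "\<not> fps_nth g m > 0" using False by blast
  then have "L \<subseteq> {..<m}" unfolding L_def by (auto simp: not_le[symmetric])
  then have fin: "finite L" by (rule finite_subset) simp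
  have trunc: "fps_truncate_pos g = (if L = {} then 0 else fps_cutoff (Suc (Max L)) g)"
    unfolding fps_truncate_pos_def L_def Let_def using False by (simp only: if_False)
  show ?thesis
  proof (cases "L = {}")
    case True
    then have "\<not> (\<forall>j\<le>i. fps_nth g j > 0)" using mem by blast
    then show ?thesis unfolding trunc by (simp only: True simp_thms if_True if_False fps_zero_nth)
  next
    case ne: False
    have "i \<le> Max L \<longleftrightarrow> i \<in> L"
    proof
      assume i: "i \<le> Max L"
      have "Max L \<in> L" using fin ne by (rule Max_in)
      then show "i \<in> L" unfolding mem using i le_trans by blast
    next
      assume "i \<in> L" then show "i \<le> Max L" using fin by (rule Max_ge[rotated])
    qed
    moreover have "fps_nth (fps_truncate_pos g) i = (if i \<le> Max L then fps_nth g i else 0)"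
      unfolding trunc using ne by (simp add: less_Suc_eq_le)
    ultimately show ?thesis by (simp only: mem)
  qed
qed (simp add: fps_truncate_pos_def)

lemma fps_nth_one_plus_X_power: "fps_nth ((1 + fps_X :: int fps) ^ n) i = int (n choose i)"
proof -
  have "fps_nth ((fps_X + 1 :: int fps) ^ n) i = (\<Sum>k\<le>n. if k = i then int (n choose i) else 0)"
    unfolding binomial_ring fps_sum_nth by (intro sum.cong) auto
  also have "\<dots> = int (n choose i)" by (simp add: binomial_eq_0)
  finally show ?thesis by (simp add: add.commute)
qed

lemma fps_nth_expected_series:
  "fps_nth ((1 + fps_X :: int fps) ^ n * (1 - fps_X ^ d)) i =
    int (n choose i) - (if d \<le> i then int (n choose (i - d)) else 0)"
  by (simp add: right_diff_distrib fps_nth_one_plus_X_power fps_X_power_mult_right_nth)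

text \<open>
  Binomial coefficients increase strictly up to the middle and are symmetric about it. So for \<open>j \<ge> d > 0\<close> the
  coefficient is non-positive exactly if \<open>j\<close> is at least as far above the middle as \<open>j - d\<close> is below it,
  that is, if \<open>n \<le> (j - d) + j\<close>, and this persists for larger indices.
  For \<open>j < d\<close> the coefficient \<open>n choose j\<close> can only vanish beyond \<open>n\<close>.
\<close>
lemma expected_series_stays_nonpos:
  assumes "fps_nth ((1 + fps_X :: int fps) ^ n * (1 - fps_X ^ d)) j \<le> 0" "j \<le> i"
  shows "fps_nth ((1 + fps_X :: int fps) ^ n * (1 - fps_X ^ d)) i \<le> 0"
proof (cases "d \<le> j")
  case True
  show ?thesis
  proof (cases "d = 0")
    case False
    then have "n \<le> (j - d) + j"
      using binomial_less_of_sum_less[of "j - d" j n] assms(1) True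
      by (force simp: fps_nth_expected_series)
    then show ?thesis
      using assms(2) True binomial_ge_of_sum_ge[of "i - d" i n] by (simp add: fps_nth_expected_series)
  qed (simp add: fps_nth_expected_series)
next
  case False
  then have "n choose j = 0" using assms(1) by (simp add: fps_nth_expected_series)
  then have "n choose i = 0" using assms(2) by (simp add: binomial_eq_0_iff)
  then show ?thesis by (simp add: fps_nth_expected_series binomial_eq_0)
qed

section \<open>The Hilbert series\<close>

text \<open>
  In degrees below \<open>d\<close> the ideal is zero; above, either injectivity makes the dimension equal to the
  coefficient, or surjectivity makes the quotient vanish while the coefficient is non-positive.
  When \<open>2 (i - d) + d = n\<close> both apply.
\<close>
lemma dim_generic_quotient:
  fixes f :: "nat set \<Rightarrow> 'k::field_char_0"
  assumes d: "even d" and f: "generic_form n d f"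
  defines "g \<equiv> (1 + fps_X :: int fps) ^ n * (1 - fps_X ^ d)"
  shows "int (vectorspace.dim class_ring (ext_quotient_degree n f i)) = max 0 (fps_nth g i)"
proof -
  have fd: "f \<in> ext_degree n d" using f by (simp add: generic_form_def)
  note dim = dim_ext_quotient_degree[OF fd d, of i]
  note ideal = ext_ideal_degree[OF fd d, of i]
  consider "i < d" | "d \<le> i" "2 * (i - d) + d \<le> n" | "d \<le> i" "n \<le> 2 * (i - d) + d"
    by linarith
  then show ?thesis
  proof cases
    case 1
    have "vectorspace.dim class_ring ((ext_component n i)\<lparr>carrier := {\<lambda>_. 0 :: 'k}\<rparr>) = 0"
      by (rule dim_ext_component_zero)
    then show ?thesis
      using dim ideal 1 by (simp add: g_def fps_nth_expected_series)
  next
    case 2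
    have "vectorspace.dim class_ring ((ext_component n i)\<lparr>carrier := ext_ideal n f \<inter> ext_degree n i\<rparr>)
        = n choose (i - d)"
      using dim_mult_image[OF fd generic_mult_injective[OF f d 2(2)]] 2(1) ideal by simp
    then show ?thesis
      using dim 2(1) by (simp add: g_def fps_nth_expected_series)
  next
    case 3
    have "ext_ideal n f \<inter> ext_degree n i = ext_degree n i"
      using generic_mult_surjective[OF f d 3(2)] 3(1) ideal by simp
    then have "(ext_component n i)\<lparr>carrier := ext_ideal n f \<inter> ext_degree n i\<rparr> = ext_component n i"
      by (simp add: ext_component_def)
    then have "vectorspace.dim class_ring (ext_quotient_degree n f i) = 0"
      using dim by (simp add: ext_component_fin_dim_dim(2))
    moreover have "n choose i \<le> n choose (i - d)"
      using 3 by (intro binomial_ge_of_sum_ge) auto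
    ultimately show ?thesis
      using 3(1) by (simp add: g_def fps_nth_expected_series)
  qed
qed

theorem theorem5p3:
  fixes n d :: nat and f :: "nat set \<Rightarrow> 'k::field_char_0"
  assumes "n > 0"
    and "even d"
    and "generic_form n d f"
  shows "hilbert_series_ext_quotient n f = fps_truncate_pos ((1 + fps_X) ^ n * (1 - fps_X ^ d))"
proof (rule fps_ext)
  fix i
  let ?g = "(1 + fps_X :: int fps) ^ n * (1 - fps_X ^ d)"
  have "fps_nth (hilbert_series_ext_quotient n f) i = max 0 (fps_nth ?g i)"
    by (simp add: hilbert_series_ext_quotient_def dim_generic_quotient[OF assms(2,3)])
  also have "\<dots> = fps_nth (fps_truncate_pos ?g) i"
    unfolding fps_truncate_pos_nth using expected_series_stays_nonpos[of n d _ i]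
    by (force simp: not_less)
  finally show "fps_nth (hilbert_series_ext_quotient n f) i = fps_nth (fps_truncate_pos ?g) i" .
qed

end
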